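(* Let $f\in\mathbb{R}_{\ge0}\mathbb{Z}$, i.e. $f$ is a nonnegative element of the real group ring $\mathbb{R}\mathbb{Z}$ of the group $\mathbb{Z}$. For $n\ge1$ let $\pi_{\mathbb{Z}/n\mathbb{Z}}\colon\mathbb{R}\mathbb{Z}\to\mathbb{R}(\mathbb{Z}/n\mathbb{Z})$ be the ring homomorphism induced by the quotient map $\mathbb{Z}\to\mathbb{Z}/n\mathbb{Z}$. Then $$\mathrm{per}(f)=\limsup_{n\to\infty}\mathrm{per}(\pi_{\mathbb{Z}/n\mathbb{Z}}(f)).$$
   Context: For a discrete group $G$ (written multiplicatively), $\mathscr{F}(G)$ is the collection of nonempty finite subsets of $G$; $\mathbb{R}G$ is the real group ring (finitely supported functions $f\colon s\mapsto f_s$) and $\mathbb{R}_{\ge0}G$ its subset of nonnegative functions. For $\mathsf{A},F\in\mathscr{F}(G)$ and $x\in\mathsf{A}^F$ let $\varphi^{(x)}\colon F\to G$, $\varphi^{(x)}(s)=sx_s$ (so $\varphi^{(x)}(s)=s+x_s$ for $G=\mathbb{Z}$ or $\mathbb{Z}/n\mathbb{Z}$), and let $X_{\mathsf{A},F}$ be the set of $x\in\mathsf{A}^F$ such that $\varphi^{(x)}$ is injective and $\varphi^{(x)}(F)\supseteq\{s\in G:s\mathsf{A}^{-1}\subseteq F\}$. Permanent: if $G$ is countable amenable and $f\in\mathbb{R}_{\ge0}G$, then $\mathrm{per}(f)=\lim_F\frac1{|F|}\log\bigl(\sum_{x\in X_{\mathsf{A},F}}\prod_{s\in F}f_{x_s}\bigr)\in[-\infty,+\infty)$,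 where $\mathsf{A}\in\mathscr{F}(G)$ is any set containing the support of $f$ (the limit exists and is independent of $\mathsf{A}$; $\log0=-\infty$). Here $\lim_F\phi(F)=C$ means that for every neighbourhood $U$ of $C$ in $[-\infty,+\infty)$ there are $K\in\mathscr{F}(G)$ and $\delta>0$ such that $\phi(F)\in U$ for all $F\in\mathscr{F}(G)$ with $|FK\vartriangle F|<\delta|F|$. In particular, if $G$ is finite and $f\neq 0$ with support $\mathsf{A}$, then $\mathrm{per}(f)=\frac1{|G|}\log\bigl(\sum_{x\in X_{\mathsf{A}}}\prod_{s\in G}f_{x_s}\bigr)$, where $X_{\mathsf{A}}$ is the set of $x\in\mathsf{A}^G$ for which $s\mapsto sx_s$ is a bijection of $G$. *)

theory Defs
  imports
    "HOL-Algebra.Elementary_Groups"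
    "HOL-Library.Poly_Mapping"
    "HOL-Library.Extended_Real"
begin

text \<open>
  An element of the real group ring of a group \<open>G\<close> is a finitely supported function
  \<open>f :: 'a \<Rightarrow>\<^sub>0 real\<close> with \<open>keys f \<subseteq> carrier G\<close>.  For the additive group of the integers
  this is the full type \<open>int \<Rightarrow>\<^sub>0 real\<close>, whose multiplication is the convolution product.
\<close>

definition nonempty_finite_subsets :: "('a, 'b) monoid_scheme \<Rightarrow> 'a set set" where
  "nonempty_finite_subsets G = {F. F \<subseteq> carrier G \<and> finite F \<and> F \<noteq> {}}"

definition restricted_injections ::
    "('a, 'b) monoid_scheme \<Rightarrow> 'a set \<Rightarrow> 'a set \<Rightarrow> ('a \<Rightarrow> 'a) set" where
  "restricted_injections G A F =
     {x \<in> F \<rightarrow>\<^sub>E A.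
        inj_on (\<lambda>s. s \<otimes>\<^bsub>G\<^esub> x s) F \<and>
        {s \<in> carrier G. s <#\<^bsub>G\<^esub> (set_inv\<^bsub>G\<^esub> A) \<subseteq> F} \<subseteq> (\<lambda>s. s \<otimes>\<^bsub>G\<^esub> x s) ` F}"

definition log_ext :: "real \<Rightarrow> ereal" where
  "log_ext r = (if r = 0 then -\<infinity> else ereal (ln r))"

definition has_folner_limit ::
    "('a, 'b) monoid_scheme \<Rightarrow> ('a set \<Rightarrow> ereal) \<Rightarrow> ereal \<Rightarrow> bool" where
  "has_folner_limit G \<phi> C \<longleftrightarrow>
     (\<forall>U. open U \<and> C \<in> U \<longrightarrow>
        (\<exists>K \<in> nonempty_finite_subsets G. \<exists>\<delta>::real. \<delta> > 0 \<and>
           (\<forall>F \<in> nonempty_finite_subsets G.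
              real (card (sym_diff (F <#>\<^bsub>G\<^esub> K) F)) < \<delta> * real (card F) \<longrightarrow> \<phi> F \<in> U)))"

definition local_per ::
    "('a, 'b) monoid_scheme \<Rightarrow> 'a set \<Rightarrow> ('a \<Rightarrow>\<^sub>0 real) \<Rightarrow> 'a set \<Rightarrow> ereal" where
  "local_per G A f F =
     log_ext (\<Sum>x \<in> restricted_injections G A F. \<Prod>s \<in> F. Poly_Mapping.lookup f (x s)) / ereal (real (card F))"

text \<open>
  The permanent is the common limit for all admissible \<open>A\<close>.  It is meaningful for amenable \<open>G\<close>
  and nonnegative \<open>f\<close> supported in \<open>carrier G\<close>; the description denotes an unspecified value
  if there is no unique such limit.
\<close>

definition per :: "('a, 'b) monoid_scheme \<Rightarrow> ('a \<Rightarrow>\<^sub>0 real) \<Rightarrow> ereal" where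
  "per G f =
     (THE C. C < \<infinity> \<and>
        (\<forall>A \<in> nonempty_finite_subsets G. Poly_Mapping.keys f \<subseteq> A \<longrightarrow> has_folner_limit G (local_per G A f) C))"

text \<open>
  The linear map of group rings that extends a map \<open>p\<close> of the underlying groups; the coefficient
  of the image at \<open>t\<close> is the sum of the coefficients of \<open>f\<close> over the fibre \<open>p s = t\<close>.
\<close>

definition group_ring_map :: "('a \<Rightarrow> 'b) \<Rightarrow> ('a \<Rightarrow>\<^sub>0 real) \<Rightarrow> ('b \<Rightarrow>\<^sub>0 real)" where
  "group_ring_map p f = (\<Sum>s \<in> Poly_Mapping.keys f. Poly_Mapping.single (p s) (Poly_Mapping.lookup f s))"

text \<open>
  The carrier of \<open>integer_mod_group n\<close> is \<open>{0..<int n}\<close> for \<open>n \<ge> 1\<close>, so the quotient map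
  from the integers takes \<open>k\<close> to \<open>k mod int n\<close>.
\<close>

definition mod_proj :: "nat \<Rightarrow> (int \<Rightarrow>\<^sub>0 real) \<Rightarrow> (int \<Rightarrow>\<^sub>0 real)" where
  "mod_proj n = group_ring_map (\<lambda>k. k mod int n)"

end

theory Submission
  imports Defs
begin

text \<open>
  Write \<open>P(F)\<close> for the weighted sum over \<open>X_{A,F}\<close>.  Restriction makes \<open>P\<close> submultiplicative on
  disjoint unions, and \<open>P\<close> is multiplicative on sets that are far apart.  Tiling a Folner set by long
  intervals bounds \<open>P(F)\<close> from above; filling its short gaps and splitting it into intervals bounds
  \<open>P(F)\<close> from below.  Hence the Folner limit over the integers is the infimum over \<open>n\<close> of
  \<open>(1/n) log P([0, n))\<close>; its independence of \<open>A\<close> follows from the formula being proved.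

  The permanent over the integers modulo \<open>n\<close> comes from a cyclic sum \<open>T n \<le> P([0, n))\<close>, so the
  limsup is at most this infimum.  For the converse, cut \<open>[0, N m)\<close> at the multiples of \<open>m\<close> and record which positions
  near each cut are already hit from the left.  If \<open>N\<close> is the number of such patterns, two cuts show
  the same pattern, and the piece between them closes up to a permutation of a cyclic group.
  Thus \<open>P([0, N m))\<close> is at most a sum of products \<open>P([0, a m)) T((b - a) m) P([0, (N - b) m))\<close>,
  in which \<open>T\<close> cannot grow at a smaller exponential rate than \<open>P\<close>.
\<close>

section \<open>Weighted sums over sets of functions\<close>

lemma sum_le_sum_inj:
  fixes g :: "'a \<Rightarrow> real"
  assumes "inj_on h S" "h ` S \<subseteq> T" "finite T"
    and "\<And>x. x \<in> S \<Longrightarrow> g x = g' (h x)" and "\<And>y. y \<in> T \<Longrightarrow> 0 \<le> g' y"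
  shows "sum g S \<le> sum g' T"
proof -
  have "sum g S = sum g' (h ` S)"
    using assms(1,4) by (simp add: sum.reindex)
  also have "\<dots> \<le> sum g' T"
    using assms(2,3,5) by (intro sum_mono2) auto
  finally show ?thesis .
qed

lemma restrict_eqD: "restrict x F = restrict y F \<Longrightarrow> s \<in> F \<Longrightarrow> x s = y s"
  by (metis restrict_apply')

text \<open>The index set \<open>S\<close> stays abstract because the same splitting estimates are
  applied to restricted injections, to cyclic injections and to mixtures of the two.\<close>

definition weight_sum :: "('a \<Rightarrow> real) \<Rightarrow> 'b set \<Rightarrow> ('b \<Rightarrow> 'a) set \<Rightarrow> real" where
  "weight_sum w F S = (\<Sum>x\<in>S. \<Prod>s\<in>F. w (x s))"

lemma weight_sum_nonneg: "(\<And>a. 0 \<le> w a) \<Longrightarrow> 0 \<le> weight_sum w F S"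
  unfolding weight_sum_def by (intro sum_nonneg prod_nonneg) auto

lemma weight_sum_mono:
  assumes "\<And>a. 0 \<le> w a" "finite T" "S \<subseteq> T"
  shows "weight_sum w F S \<le> weight_sum w F T"
  unfolding weight_sum_def using assms by (intro sum_mono2 prod_nonneg) auto

lemma weight_sum_mult:
  assumes "finite F1" "finite F2"
  shows "weight_sum w F1 S1 * weight_sum w F2 S2
    = (\<Sum>p\<in>S1 \<times> S2. (\<Prod>s\<in>F1. w (fst p s)) * (\<Prod>s\<in>F2. w (snd p s)))"
  unfolding weight_sum_def by (simp add: sum_product sum.cartesian_product split_def)

text \<open>An extensional function on the union is determined by its two restrictions, and its
  weight is the product of theirs. Nonnegativity then allows summation over all pairs in
  \<open>S1 \<times> S2\<close>.\<close>

lemma weight_sum_Un_le: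
  assumes w: "\<And>a. 0 \<le> w a" and F: "finite F1" "finite F2" "F1 \<inter> F2 = {}"
    and S: "S \<subseteq> extensional (F1 \<union> F2)" "finite S1" "finite S2"
    and r: "\<And>x. x \<in> S \<Longrightarrow> restrict x F1 \<in> S1" "\<And>x. x \<in> S \<Longrightarrow> restrict x F2 \<in> S2"
  shows "weight_sum w (F1 \<union> F2) S \<le> weight_sum w F1 S1 * weight_sum w F2 S2"
  unfolding weight_sum_mult[OF F(1,2)] unfolding weight_sum_def
proof (rule sum_le_sum_inj[where h = "\<lambda>x. (restrict x F1, restrict x F2)"])
  show "inj_on (\<lambda>x. (restrict x F1, restrict x F2)) S"
  proof (rule inj_onI)
    fix x y assume "x \<in> S" "y \<in> S" and eq: "(restrict x F1, restrict x F2) = (restrict y F1, restrict y F2)"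
    then have "x \<in> extensional (F1 \<union> F2)" "y \<in> extensional (F1 \<union> F2)" using S by auto
    moreover have "x s = y s" if "s \<in> F1 \<union> F2" for s
      using eq that by (auto dest: restrict_eqD)
    ultimately show "x = y" by (rule extensionalityI)
  qed
  show "(\<Prod>s\<in>F1 \<union> F2. w (x s)) = (\<Prod>s\<in>F1. w (fst (restrict x F1, restrict x F2) s)) * (\<Prod>s\<in>F2. w (snd (restrict x F1, restrict x F2) s))" for x
    using F by (simp add: prod.union_disjoint)
qed (use r S w in \<open>auto intro!: mult_nonneg_nonneg prod_nonneg\<close>)

text \<open>Gluing is injective because the pieces are extensional on disjoint sets, and distinct
  glued functions contribute separately to the sum over \<open>S\<close>.\<close>

lemma weight_sum_Un_ge:
  assumes w: "\<And>a. 0 \<le> w a" and F: "finite F1" "finite F2" "F1 \<inter> F2 = {}"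
    and S: "S1 \<subseteq> extensional F1" "S2 \<subseteq> extensional F2" "finite S"
    and r: "\<And>x y. x \<in> S1 \<Longrightarrow> y \<in> S2 \<Longrightarrow> (\<lambda>s. if s \<in> F1 then x s else y s) \<in> S"
  shows "weight_sum w F1 S1 * weight_sum w F2 S2 \<le> weight_sum w (F1 \<union> F2) S"
  unfolding weight_sum_mult[OF F(1,2)] unfolding weight_sum_def
proof (rule sum_le_sum_inj[where h = "\<lambda>p s. if s \<in> F1 then fst p s else snd p s"])
  show "inj_on (\<lambda>p s. if s \<in> F1 then fst p s else snd p s) (S1 \<times> S2)"
  proof (rule inj_onI)
    fix p q assume pq: "p \<in> S1 \<times> S2" "q \<in> S1 \<times> S2"
      and "(\<lambda>s. if s \<in> F1 then fst p s else snd p s) = (\<lambda>s. if s \<in> F1 then fst q s else snd q s)"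
    from fun_cong[OF this(3)]
    have eq: "(if s \<in> F1 then fst p s else snd p s) = (if s \<in> F1 then fst q s else snd q s)" for s .
    have "fst p = fst q"
    proof (rule extensionalityI[of _ F1])
      fix s assume "s \<in> F1"
      then show "fst p s = fst q s" using eq[of s] by simp
    qed (use pq S in auto)
    moreover have "snd p = snd q"
    proof (rule extensionalityI[of _ F2])
      fix s assume "s \<in> F2"
      then have "s \<notin> F1" using F by auto
      then show "snd p s = snd q s" using eq[of s] by simp
    qed (use pq S in auto)
    ultimately show "p = q" by (rule prod_eqI)
  qed
  show "(\<Prod>s\<in>F1. w (fst p s)) * (\<Prod>s\<in>F2. w (snd p s))
    = (\<Prod>s\<in>F1 \<union> F2. w (if s \<in> F1 then fst p s else snd p s))" for p
  proof -
    have "(\<Prod>s\<in>F2. w (if s \<in> F1 then fst p s else snd p s)) = (\<Prod>s\<in>F2. w (snd p s))"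
      using F by (intro prod.cong) auto
    then show ?thesis using F by (simp add: prod.union_disjoint)
  qed
qed (use r S w in \<open>auto intro!: prod_nonneg\<close>)

lemma weight_sum_shift_le:
  fixes c :: "'b :: cancel_semigroup_add"
  assumes w: "\<And>a. 0 \<le> w a" and S: "S \<subseteq> extensional ((\<lambda>s. s + c) ` F)" "finite S'"
    and r: "\<And>x. x \<in> S \<Longrightarrow> (\<lambda>s\<in>F. x (s + c)) \<in> S'"
  shows "weight_sum w ((\<lambda>s. s + c) ` F) S \<le> weight_sum w F S'"
  unfolding weight_sum_def
proof (rule sum_le_sum_inj[where h = "\<lambda>x. \<lambda>s\<in>F. x (s + c)"])
  show "inj_on (\<lambda>x. \<lambda>s\<in>F. x (s + c)) S"
  proof (rule inj_onI)
    fix x y assume "x \<in> S" "y \<in> S" and eq: "(\<lambda>s\<in>F. x (s + c)) = (\<lambda>s\<in>F. y (s + c))"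
    then have "x \<in> extensional ((\<lambda>s. s + c) ` F)" "y \<in> extensional ((\<lambda>s. s + c) ` F)"
      using S by auto
    moreover have "x s = y s" if "s \<in> (\<lambda>s. s + c) ` F" for s
      using that restrict_eqD[OF eq] by auto
    ultimately show "x = y" by (rule extensionalityI)
  qed
  show "(\<Prod>s\<in>(\<lambda>s. s + c) ` F. w (x s)) = (\<Prod>s\<in>F. w ((\<lambda>s\<in>F. x (s + c)) s))" for x
    by (subst prod.reindex) (auto simp: inj_on_def)
qed (use r S w in \<open>auto intro!: prod_nonneg\<close>)

subsection \<open>Submultiplicativity over the integers\<close>

text \<open>The points \<open>t\<close> that must be hit are those all of whose possible sources
  \<open>t - a\<close> lie in \<open>F\<close>. The later arguments use the covering condition in
  this form.\<close>

lemma mem_restricted_injections_integer_group: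
  "x \<in> restricted_injections integer_group A F \<longleftrightarrow>
    x \<in> F \<rightarrow>\<^sub>E A \<and> inj_on (\<lambda>s. s + x s) F \<and>
    (\<forall>t. (\<forall>a\<in>A. t - a \<in> F) \<longrightarrow> t \<in> (\<lambda>s. s + x s) ` F)"
proof -
  have "set_inv\<^bsub>integer_group\<^esub> A = uminus ` A"
    by (auto simp: SET_INV_def)
  then have "s <#\<^bsub>integer_group\<^esub> (set_inv\<^bsub>integer_group\<^esub> A) = (\<lambda>a. s - a) ` A" for s
    by (auto simp: l_coset_def)
  then show ?thesis
    by (simp add: restricted_injections_def image_subset_iff subset_iff[where B = "_ ` _"])
qed

lemma finite_restricted_injections:
  "finite A \<Longrightarrow> finite F \<Longrightarrow> finite (restricted_injections G A F)"
  by (rule finite_subset[of _ "F \<rightarrow>\<^sub>E A"]) (auto simp: restricted_injections_def intro: finite_PiE)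

text \<open>No point moves by more than \<open>d\<close>. Nonemptiness of \<open>A\<close> excludes
  the degenerate case in which the covering condition would require every integer to be hit.\<close>

locale weighted_shifts =
  fixes w :: "int \<Rightarrow> real" and A :: "int set" and d :: int
  assumes w_nonneg: "0 \<le> w a"
    and A_finite: "finite A" and A_nonempty: "A \<noteq> {}" and A_bounded: "A \<subseteq> {-d..d}"
begin

definition P :: "int set \<Rightarrow> real" where
  "P F = weight_sum w F (restricted_injections integer_group A F)"

definition C :: real where
  "C = 1 + sum w A"  \<comment> \<open>the summand 1 ensures \<open>0 \<le> ln C\<close>\<close>

lemma A_bound: "a \<in> A \<Longrightarrow> - d \<le> a \<and> a \<le> d"
  using A_bounded by auto

lemma d_nonneg: "0 \<le> d"
  using A_nonempty A_bounded by auto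

lemma C_ge_1: "1 \<le> C"
  unfolding C_def using w_nonneg by (simp add: sum_nonneg)

lemma P_nonneg: "0 \<le> P F"
  unfolding P_def by (rule weight_sum_nonneg) (rule w_nonneg)

lemma P_empty: "P {} = 1"
proof -
  have "restricted_injections integer_group A {} = {\<lambda>_. undefined}"
    using A_nonempty by (auto simp: mem_restricted_injections_integer_group)
  then show ?thesis by (simp add: P_def weight_sum_def)
qed

text \<open>Dropping injectivity and covering leaves the sum over all functions from
  \<open>F\<close> to \<open>A\<close>, which factors over the points of \<open>F\<close>.\<close>

lemma P_le_power:
  assumes "finite F"
  shows "P F \<le> C ^ card F"
proof -
  have "P F \<le> weight_sum w F (F \<rightarrow>\<^sub>E A)"
    unfolding P_def using assms A_finite w_nonneg
    by (intro weight_sum_mono finite_PiE) (auto simp: restricted_injections_def)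
  also have "\<dots> = sum w A ^ card F"
    unfolding weight_sum_def using prod_sum_PiE[of F "\<lambda>_. A" "\<lambda>_. w"] assms A_finite by simp
  also have "\<dots> \<le> C ^ card F"
    by (intro power_mono) (auto simp: C_def sum_nonneg w_nonneg)
  finally show ?thesis .
qed

text \<open>If every possible source of \<open>t\<close> lies in \<open>F1\<close>, then so does the
  point of \<open>F\<close> that actually hits \<open>t\<close>. Hence covering survives
  restriction, as injectivity does.\<close>

lemma restrict_restricted_injections:
  assumes x: "x \<in> restricted_injections integer_group A F" and "F1 \<subseteq> F"
  shows "restrict x F1 \<in> restricted_injections integer_group A F1"
proof -
  from x have x1: "x \<in> F \<rightarrow>\<^sub>E A" and x2: "inj_on (\<lambda>s. s + x s) F"
    and x3: "\<And>t. (\<forall>a\<in>A. t - a \<in> F) \<Longrightarrow> t \<in> (\<lambda>s. s + x s) ` F"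
    by (auto simp: mem_restricted_injections_integer_group)
  have "inj_on (\<lambda>s. s + restrict x F1 s) F1"
    using inj_on_subset[OF x2 \<open>F1 \<subseteq> F\<close>] by (auto simp: inj_on_def)
  moreover have "t \<in> (\<lambda>s. s + restrict x F1 s) ` F1" if t: "\<forall>a\<in>A. t - a \<in> F1" for t
  proof -
    from t \<open>F1 \<subseteq> F\<close> x3 obtain s where s: "s \<in> F" "t = s + x s" by blast
    with x1 have "x s \<in> A" by auto
    with t s have "s \<in> F1" by force
    with s show ?thesis by auto
  qed
  ultimately show ?thesis
    using x1 \<open>F1 \<subseteq> F\<close> by (auto simp: mem_restricted_injections_integer_group)
qed

lemma restricted_injections_extensional:
  "restricted_injections G A F \<subseteq> extensional F"
  by (auto simp: restricted_injections_def PiE_def)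

lemma P_Un_le:
  assumes "finite F1" "finite F2" "F1 \<inter> F2 = {}"
  shows "P (F1 \<union> F2) \<le> P F1 * P F2"
  unfolding P_def
  by (intro weight_sum_Un_le finite_restricted_injections restrict_restricted_injections
      w_nonneg assms A_finite restricted_injections_extensional) auto

lemma P_shift_le:
  assumes "finite F"
  shows "P ((\<lambda>s. s + c) ` F) \<le> P F"
  unfolding P_def
proof (intro weight_sum_shift_le finite_restricted_injections w_nonneg A_finite assms
    restricted_injections_extensional)
  fix x assume "x \<in> restricted_injections integer_group A ((\<lambda>s. s + c) ` F)"
  then have x1: "x \<in> (\<lambda>s. s + c) ` F \<rightarrow>\<^sub>E A" and x2: "inj_on (\<lambda>s. s + x s) ((\<lambda>s. s + c) ` F)"
    and x3: "\<And>t. (\<forall>a\<in>A. t - a \<in> (\<lambda>s. s + c) ` F) \<Longrightarrow> t \<in> (\<lambda>s. s + x s) ` (\<lambda>s. s + c) ` F"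
    by (auto simp: mem_restricted_injections_integer_group)
  have "inj_on (\<lambda>s. s + (\<lambda>s\<in>F. x (s + c)) s) F"
  proof (rule inj_onI)
    fix s t assume "s \<in> F" "t \<in> F" "s + (\<lambda>s\<in>F. x (s + c)) s = t + (\<lambda>s\<in>F. x (s + c)) t"
    then show "s = t"
      using inj_onD[OF x2, of "s + c" "t + c"] by auto
  qed
  moreover have "t \<in> (\<lambda>s. s + (\<lambda>s\<in>F. x (s + c)) s) ` F" if t: "\<forall>a\<in>A. t - a \<in> F" for t
  proof -
    have "\<forall>a\<in>A. (t + c) - a \<in> (\<lambda>s. s + c) ` F"
      using t by (force simp: image_iff)
    then obtain s where "s \<in> F" "t + c = s + c + x (s + c)" using x3 by fastforce
    then show ?thesis by (auto simp: image_iff intro!: bexI[of _ s])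
  qed
  moreover have "(\<lambda>s\<in>F. x (s + c)) \<in> F \<rightarrow>\<^sub>E A"
    using x1 by auto
  ultimately show "(\<lambda>s\<in>F. x (s + c)) \<in> restricted_injections integer_group A F"
    unfolding mem_restricted_injections_integer_group by blast
qed

lemma P_shift:
  assumes "finite F"
  shows "P ((\<lambda>s. s + c) ` F) = P F"
proof (rule antisym)
  have eq: "(\<lambda>s. s + - c) ` (\<lambda>s. s + c) ` F = F"
    by (auto simp: image_iff)
  show "P F \<le> P ((\<lambda>s. s + c) ` F)"
    using P_shift_le[of "(\<lambda>s. s + c) ` F" "- c"] assms unfolding eq by blast
qed (rule P_shift_le[OF assms])

lemma P_interval: "P {a..<b} = P {0..<b - a}"
proof -
  have eq: "(\<lambda>s. s + a) ` {0..<b - a} = {a..<b}" by simp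
  show ?thesis using P_shift[of "{0..<b - a}" a] unfolding eq by blast
qed

text \<open>
  Beyond distance \<open>2 * d\<close> the images of the two parts are disjoint, and no translate of \<open>- A\<close>
  meets both parts, so the covering condition decouples as well.
\<close>

lemma P_Un_ge:
  assumes F: "finite F1" "finite F2" and sep: "\<And>s t. s \<in> F1 \<Longrightarrow> t \<in> F2 \<Longrightarrow> s + 2 * d < t"
  shows "P F1 * P F2 \<le> P (F1 \<union> F2)"
proof -
  have disj: "F1 \<inter> F2 = {}" using sep d_nonneg by fastforce
  show ?thesis
    unfolding P_def
  proof (intro weight_sum_Un_ge finite_restricted_injections w_nonneg A_finite F disj
      restricted_injections_extensional)
    fix x y assume x: "x \<in> restricted_injections integer_group A F1"
      and y: "y \<in> restricted_injections integer_group A F2"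
    define z where "z = (\<lambda>s. if s \<in> F1 then x s else y s)"
    have z1: "z s = x s" if "s \<in> F1" for s using that by (simp add: z_def)
    have z2: "z s = y s" if "s \<in> F2" for s using that disj by (auto simp: z_def)
    have xA: "x s \<in> A" if "s \<in> F1" for s
      using that x by (auto simp: mem_restricted_injections_integer_group)
    have yA: "y s \<in> A" if "s \<in> F2" for s
      using that y by (auto simp: mem_restricted_injections_integer_group)
    have "z \<in> F1 \<union> F2 \<rightarrow>\<^sub>E A"
      using x y by (auto simp: mem_restricted_injections_integer_group z_def PiE_iff extensional_def)
    moreover have "inj_on (\<lambda>s. s + z s) (F1 \<union> F2)"
    proof (rule inj_onI)
      have mixed: "s + x s \<noteq> t + y t" if "s \<in> F1" "t \<in> F2" for s t
        using sep[OF that] A_bound[OF xA[OF that(1)]] A_bound[OF yA[OF that(2)]] by linarith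
      fix s t assume "s \<in> F1 \<union> F2" "t \<in> F1 \<union> F2" "s + z s = t + z t"
      moreover have "inj_on (\<lambda>s. s + x s) F1" "inj_on (\<lambda>s. s + y s) F2"
        using x y by (auto simp: mem_restricted_injections_integer_group)
      ultimately show "s = t"
        using mixed[of s t] mixed[of t s] by (auto simp: z1 z2 dest: inj_onD)
    qed
    moreover have "t \<in> (\<lambda>s. s + z s) ` (F1 \<union> F2)" if t: "\<forall>a\<in>A. t - a \<in> F1 \<union> F2" for t
    proof -
      have "(\<forall>a\<in>A. t - a \<in> F1) \<or> (\<forall>a\<in>A. t - a \<in> F2)"
      proof (rule ccontr)
        assume "\<not> ?thesis"
        with t obtain a b where "a \<in> A" "b \<in> A" "t - a \<in> F1" "t - b \<in> F2" by blast
        then show False using sep[of "t - a" "t - b"] A_bound[of a] A_bound[of b] by linarith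
      qed
      then have "t \<in> (\<lambda>s. s + x s) ` F1 \<or> t \<in> (\<lambda>s. s + y s) ` F2"
        using x y by (auto simp: mem_restricted_injections_integer_group)
      then show ?thesis by (auto simp: z1 z2 image_iff) (metis UnCI z1 z2)+
    qed
    ultimately show "(\<lambda>s. if s \<in> F1 then x s else y s) \<in> restricted_injections integer_group A (F1 \<union> F2)"
      unfolding mem_restricted_injections_integer_group z_def[symmetric] by blast
  qed (simp add: F)
qed

end

subsection \<open>From intervals to Folner sets\<close>

text \<open>For \<open>0 \<le> L\<close> this is the symmetric difference in the Folner condition
  with \<open>K = {-L..L}\<close>, so errors proportional to its size are negligible on Folner
  sets.\<close>

definition collar :: "int \<Rightarrow> int set \<Rightarrow> int set" where
  "collar L F = {t. t \<notin> F \<and> (\<exists>s\<in>F. \<bar>t - s\<bar> \<le> L)}"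

lemma finite_collar:
  assumes "finite F"
  shows "finite (collar L F)"
proof (rule finite_subset)
  show "collar L F \<subseteq> (\<Union>s\<in>F. {s - L..s + L})"
    by (force simp: collar_def)
qed (use assms in auto)

lemma collar_mono: "L \<le> M \<Longrightarrow> collar L F \<subseteq> collar M F"
  by (force simp: collar_def)

lemma block_disjoint:
  fixes L :: int
  assumes "0 < L" "i \<noteq> j"
  shows "{i * L..<i * L + L} \<inter> {j * L..<j * L + L} = {}"
proof -
  have "s div L = k" if "s \<in> {k * L..<k * L + L}" for s k
    using that \<open>0 < L\<close> by (intro int_div_pos_eq[where r = "s - k * L"]) auto
  then show ?thesis using \<open>i \<noteq> j\<close> by blast
qed

context weighted_shifts
begin

text \<open>The hypothesis \<open>gap\<close> says that more than \<open>2 * d\<close> separates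
  consecutive runs of \<open>F\<close>. Induction removes the leftmost run, which is independent of
  the rest by \<open>P_Un_ge\<close>.\<close>

lemma P_ge_of_separated:
  assumes "finite F" "0 \<le> r" and r: "\<And>n. r ^ n \<le> P {0..<int n}"
    and gap: "\<And>s t. s \<in> F \<Longrightarrow> s + 1 \<notin> F \<Longrightarrow> s < t \<Longrightarrow> t \<le> s + 2 * d \<Longrightarrow> t \<notin> F"
  shows "r ^ card F \<le> P F"
  using \<open>finite F\<close> gap
proof (induction F rule: finite_psubset_induct)
  case (psubset F)
  show ?case
  proof (cases "F = {}")
    case True
    then show ?thesis by (simp add: P_empty)
  next
    case False
    define u where "u = Min F"
    have u: "u \<in> F" "\<And>s. s \<in> F \<Longrightarrow> u \<le> s"
      using False psubset.hyps by (auto simp: u_def)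
    have "\<exists>n. u + int n \<notin> F"
    proof (rule ccontr)
      assume "\<not> ?thesis"
      then have "range (\<lambda>n. u + int n) \<subseteq> F" by auto
      moreover have "inj (\<lambda>n. u + int n)" by (auto simp: inj_on_def)
      ultimately show False
        using psubset.hyps by (metis finite_imageD finite_subset infinite_UNIV_nat)
    qed
    \<comment> \<open>The length of the maximal run of \<open>F\<close> that starts at its
      minimum.\<close>
    define n where "n = (LEAST n. u + int n \<notin> F)"
    have n: "u + int n \<notin> F"
      unfolding n_def by (rule LeastI_ex) fact
    have below: "u + int i \<in> F" if "i < n" for i
      using not_less_Least[OF that[unfolded n_def]] by simp
    have "n \<noteq> 0" using n u by (metis add.right_neutral of_nat_0)
    define I where "I = {u..<u + int n}"
    have I: "I \<subseteq> F"
    proof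
      fix s assume "s \<in> I"
      then show "s \<in> F" using below[of "nat (s - u)"] by (auto simp: I_def)
    qed
    have beyond: "u + int n < t" if "t \<in> F - I" for t
    proof -
      have "u \<le> t" "t \<noteq> u + int n" using that u(2)[of t] n by auto
      then show ?thesis using that by (auto simp: I_def)
    qed
    have last: "u + int n - 1 \<in> F" using below[of "n - 1"] \<open>n \<noteq> 0\<close> by (simp add: of_nat_diff algebra_simps)
    have sep: "s + 2 * d < t" if "s \<in> I" "t \<in> F - I" for s t
    proof -
      have "\<not> t \<le> (u + int n - 1) + 2 * d"
        using psubset.prems[of "u + int n - 1" t] last n beyond[OF that(2)] that(2) by auto
      then show ?thesis using that(1) by (auto simp: I_def)
    qed
    have "r ^ card (F - I) \<le> P (F - I)"
    proof (rule psubset.IH)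
      have "u \<in> I" using \<open>n \<noteq> 0\<close> by (auto simp: I_def)
      then show "F - I \<subset> F" using u by auto
    next
      fix s t assume s: "s \<in> F - I" "s + 1 \<notin> F - I" and t: "s < t" "t \<le> s + 2 * d"
      \<comment> \<open>A right end of a run in \<open>F - I\<close> is also one in
        \<open>F\<close>: its successor lies beyond \<open>I\<close>, so it was not removed with
        \<open>I\<close>.\<close>
      have "s + 1 \<notin> I" using beyond[OF s(1)] by (auto simp: I_def)
      with s t psubset.prems[of s t] show "t \<notin> F - I" by auto
    qed
    moreover have "r ^ card I \<le> P I"
      using r[of n] P_interval[of u "u + int n"] by (simp add: I_def)
    ultimately have "r ^ card I * r ^ card (F - I) \<le> P I * P (F - I)"
      using \<open>0 \<le> r\<close> P_nonneg by (intro mult_mono) auto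
    also have "\<dots> \<le> P (I \<union> (F - I))"
      using psubset.hyps I sep by (intro P_Un_ge) (auto intro: finite_subset)
    finally show ?thesis
      using I psubset.hyps
      by (metis Un_Diff_cancel Un_absorb1 card_Diff_subset card_mono finite_subset
          le_add_diff_inverse power_add)
  qed
qed

text \<open>
  Filling the gaps of length at most \<open>2 * d\<close> enlarges \<open>F\<close> within its collar only, which costs
  little by submultiplicativity, and leaves intervals far enough apart to be independent.
\<close>

lemma P_ge_of_interval_bound:
  assumes F: "finite F" and q: "\<And>n. exp (q * real n) \<le> P {0..<int n}"
  shows "exp (q * real (card F) - (\<bar>q\<bar> + ln C) * real (card (collar (2 * d) F))) \<le> P F"
proof -
  define F' where "F' = {t. \<exists>s\<in>F. \<exists>s'\<in>F. s \<le> t \<and> t \<le> s' \<and> s' \<le> s + 2 * d}"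
  have sub: "F \<subseteq> F'" using d_nonneg by (force simp: F'_def)
  have diff: "F' - F \<subseteq> collar (2 * d) F" by (force simp: F'_def collar_def)
  have fin: "finite (F' - F)" using diff F by (blast intro: finite_subset finite_collar)
  then have fin': "finite F'" using F by (metis finite_Diff2)
  define k where "k = card (F' - F)"
  define c where "c = card (collar (2 * d) F)"
  have kc: "k \<le> c" unfolding k_def c_def using diff F by (intro card_mono finite_collar)
  have "exp q ^ card F' \<le> P F'"
  proof (rule P_ge_of_separated[OF fin'])
    show "exp q ^ n \<le> P {0..<int n}" for n
      using q[of n] by (simp add: exp_of_nat2_mult[symmetric] mult.commute)
    fix s t assume s: "s \<in> F'" "s + 1 \<notin> F'" and t: "s < t" "t \<le> s + 2 * d"
    obtain s0 s1 where s01: "s0 \<in> F" "s1 \<in> F" "s0 \<le> s" "s \<le> s1" "s1 \<le> s0 + 2 * d"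
      using s(1) by (auto simp: F'_def)
    \<comment> \<open>Otherwise \<open>s + 1\<close> would still lie between \<open>s0\<close> and
      \<open>s1\<close>, hence in \<open>F'\<close>. So \<open>s\<close> itself belongs to
      \<open>F\<close>.\<close>
    have "s1 = s" using s(2) s01 by (force simp: F'_def)
    show "t \<notin> F'"
    proof
      assume "t \<in> F'"
      then obtain t0 t1 where t01: "t0 \<in> F" "t1 \<in> F" "t0 \<le> t" "t \<le> t1" "t1 \<le> t0 + 2 * d"
        by (auto simp: F'_def)
      have "s + 1 \<in> F'"
      proof (cases "t0 \<le> s")
        case True
        then show ?thesis unfolding F'_def using t01 t by (intro CollectI bexI[of _ t0] bexI[of _ t1]) auto
      next
        \<comment> \<open>Now \<open>s\<close> and \<open>t0\<close> are points of \<open>F\<close>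
          at distance at most \<open>2 * d\<close>, so \<open>s + 1\<close> was filled in between
          them.\<close>
        case False
        then show ?thesis unfolding F'_def using t01 t s01 \<open>s1 = s\<close>
          by (intro CollectI bexI[of _ s] bexI[of _ t0]) auto
      qed
      then show False using s(2) by simp
    qed
  qed auto
  also have "P F' = P (F \<union> (F' - F))" using sub by (simp add: Un_absorb1)
  also have "\<dots> \<le> P F * P (F' - F)" using F fin by (intro P_Un_le) auto
  also have "\<dots> \<le> P F * C ^ k"
    unfolding k_def by (intro mult_left_mono P_le_power P_nonneg fin)
  also have "\<dots> \<le> P F * C ^ c"
    using kc C_ge_1 by (intro mult_left_mono power_increasing P_nonneg)
  finally have *: "exp q ^ card F' \<le> P F * C ^ c" .
  have "card F' = card F + k"
    unfolding k_def using sub F fin' by (simp add: card_Diff_subset card_mono)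
  then have "exp q ^ card F' = exp (q * real (card F) + q * real k)"
    by (simp add: exp_of_nat2_mult[symmetric] algebra_simps)
  \<comment> \<open>The sign of \<open>q\<close> is unknown, so the added points may change the
    exponent in either direction; the absolute value covers both cases.\<close>
  moreover have "- \<bar>q\<bar> * real c \<le> q * real k"
  proof -
    have "- (q * real k) \<le> \<bar>q\<bar> * real k" by (metis abs_ge_minus_self abs_mult abs_of_nat)
    also have "\<dots> \<le> \<bar>q\<bar> * real c" using kc by (intro mult_left_mono) auto
    finally show ?thesis by simp
  qed
  ultimately have "exp (q * real (card F) - \<bar>q\<bar> * real c) \<le> P F * C ^ c"
    using * by (smt (verit, ccfv_threshold) exp_le_cancel_iff mult_minus_left)
  moreover have "C ^ c = exp (ln C * real c)"
    using C_ge_1 by (simp add: exp_of_nat2_mult)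
  ultimately have "exp (q * real (card F) - \<bar>q\<bar> * real c) / exp (ln C * real c) \<le> P F"
    by (simp add: pos_divide_le_eq)
  then show ?thesis
    unfolding c_def by (simp add: exp_diff[symmetric] algebra_simps)
qed

lemma P_blocks_le:
  assumes "finite J" and L: "0 < L"
  shows "P (\<Union>j\<in>J. {j * L..<j * L + L}) \<le> P {0..<L} ^ card J"
  using \<open>finite J\<close>
proof (induction J rule: finite_induct)
  case empty
  then show ?case by (simp add: P_empty)
next
  case (insert j J)
  have "P (\<Union>j\<in>insert j J. {j * L..<j * L + L})
      \<le> P {j * L..<j * L + L} * P (\<Union>j\<in>J. {j * L..<j * L + L})"
    unfolding UN_insert
  proof (rule P_Un_le)
    show "{j * L..<j * L + L} \<inter> (\<Union>j\<in>J. {j * L..<j * L + L}) = {}"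
      using insert.hyps block_disjoint[OF L, of j] by fastforce
  qed (use insert.hyps in auto)
  also have "P {j * L..<j * L + L} = P {0..<L}"
    using P_interval[of "j * L" "j * L + L"] by simp
  also have "P {0..<L} * P (\<Union>j\<in>J. {j * L..<j * L + L}) \<le> P {0..<L} * P {0..<L} ^ card J"
    by (intro mult_left_mono insert.IH P_nonneg)
  finally show ?case using insert.hyps by simp
qed

text \<open>Keep the aligned blocks of length \<open>L\<close> contained in \<open>F\<close>. Any
  other point of \<open>F\<close> shares its block with a point outside \<open>F\<close>, so it is
  within \<open>L\<close> of the collar; this gives the factor \<open>2 * L + 1\<close>. Each
  leftover point costs at most \<open>C\<close>, and replacing \<open>card F0\<close> by
  \<open>card F\<close> in the exponent costs \<open>\<bar>q\<bar>\<close> per leftover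
  point.\<close>

lemma P_le_of_interval_bound:
  assumes F: "finite F" and L: "0 < L" and q: "P {0..<int L} \<le> exp (q * real L)"
  shows "P F \<le> exp (q * real (card F)
    + (2 * real L + 1) * (\<bar>q\<bar> + ln C) * real (card (collar (int L) F)))"
proof -
  let ?B = "\<lambda>j. {j * int L..<j * int L + int L}"
  define J where "J = {j. ?B j \<subseteq> F}"
  define F0 where "F0 = (\<Union>j\<in>J. ?B j)"
  have "J \<subseteq> (\<lambda>s. s div int L) ` F"
  proof
    fix j assume "j \<in> J"
    then have "j * int L \<in> F" using L by (auto simp: J_def)
    then show "j \<in> (\<lambda>s. s div int L) ` F" using L by (force simp: image_iff)
  qed
  then have J: "finite J" using F by (meson finite_imageI finite_subset)
  have F0: "F0 \<subseteq> F" by (auto simp: F0_def J_def)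
  have "card F0 = (\<Sum>j\<in>J. card (?B j))"
    unfolding F0_def using J L block_disjoint[of "int L"] by (intro card_UN_disjoint) auto
  then have card0: "card F0 = L * card J" by simp
  define k where "k = card (F - F0)"
  define c where "c = card (collar (int L) F)"
  have "F - F0 \<subseteq> (\<Union>t\<in>collar (int L) F. {t - int L..t + int L})"
  proof
    fix s assume s: "s \<in> F - F0"
    have sB: "s \<in> ?B (s div int L)"
    proof -
      have "0 \<le> s mod int L" "s mod int L < int L" using L by auto
      then show ?thesis using div_mult_mod_eq[of s "int L"] by (simp only: atLeastLessThan_iff) linarith
    qed
    then have "\<not> ?B (s div int L) \<subseteq> F"
      using s by (auto simp: F0_def J_def)
    then obtain t where t: "t \<in> ?B (s div int L)" "t \<notin> F" by blast
    have "\<bar>t - s\<bar> \<le> int L" using sB t(1) by auto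
    then have "t \<in> collar (int L) F" "s \<in> {t - int L..t + int L}"
      using s t by (auto simp: collar_def)
    then show "s \<in> (\<Union>t\<in>collar (int L) F. {t - int L..t + int L})" by blast
  qed
  then have "k \<le> card (\<Union>t\<in>collar (int L) F. {t - int L..t + int L})"
    unfolding k_def using F finite_collar by (intro card_mono) auto
  also have "\<dots> \<le> (\<Sum>t\<in>collar (int L) F. card {t - int L..t + int L})"
    using F finite_collar by (intro card_UN_le) auto
  also have "\<dots> = c * (2 * L + 1)"
  proof -
    have "card {t - int L..t + int L} = 2 * L + 1" for t by simp
    then show ?thesis by (simp add: c_def)
  qed
  finally have "real k \<le> real (c * (2 * L + 1))" by (rule of_nat_mono)
  then have kc: "real k \<le> (2 * real L + 1) * real c" by (simp add: algebra_simps)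
  have "P F = P (F0 \<union> (F - F0))" using F0 by (simp add: Un_absorb1)
  also have "\<dots> \<le> P F0 * P (F - F0)" using F F0 by (intro P_Un_le) (auto intro: finite_subset)
  also have "\<dots> \<le> exp (q * real L) ^ card J * C ^ k"
  proof (intro mult_mono)
    have "P F0 \<le> P {0..<int L} ^ card J"
      unfolding F0_def using J L by (intro P_blocks_le) auto
    also have "\<dots> \<le> exp (q * real L) ^ card J"
      by (intro power_mono q P_nonneg)
    finally show "P F0 \<le> exp (q * real L) ^ card J" .
    show "P (F - F0) \<le> C ^ k" unfolding k_def using F by (intro P_le_power) auto
  qed (auto intro: P_nonneg)
  also have "exp (q * real L) ^ card J = exp (q * real (card F0))"
    by (simp add: card0 exp_of_nat2_mult[symmetric])
  also have "C ^ k = exp (ln C * real k)"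
    using C_ge_1 by (simp add: exp_of_nat2_mult)
  also have "exp (q * real (card F0)) * exp (ln C * real k) = exp (q * real (card F0) + ln C * real k)"
    by (simp add: exp_add)
  also have "\<dots> \<le> exp (q * real (card F) + (2 * real L + 1) * (\<bar>q\<bar> + ln C) * real c)"
  proof -
    have "card F = card F0 + k"
      unfolding k_def using F0 F by (metis card_Diff_subset card_mono finite_subset le_add_diff_inverse)
    then have "q * real (card F0) + ln C * real k = q * real (card F) + (ln C - q) * real k"
      by (simp add: algebra_simps)
    also have "\<dots> \<le> q * real (card F) + (\<bar>q\<bar> + ln C) * real k"
      by (intro add_left_mono mult_right_mono) auto
    also have "\<dots> \<le> q * real (card F) + (\<bar>q\<bar> + ln C) * ((2 * real L + 1) * real c)"
      using C_ge_1 kc by (intro add_left_mono mult_left_mono) auto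
    finally show ?thesis by (simp add: algebra_simps)
  qed
  finally show ?thesis unfolding c_def .
qed

end

subsection \<open>Cyclic sums\<close>

lemma weight_sum_UN_le:
  assumes w: "\<And>a. 0 \<le> w a" and Q: "finite Q" and E: "\<And>q. q \<in> Q \<Longrightarrow> finite (E q)"
  shows "weight_sum w F (\<Union>q\<in>Q. E q) \<le> (\<Sum>q\<in>Q. weight_sum w F (E q))"
  using Q E
proof (induction Q rule: finite_induct)
  case empty
  then show ?case by (simp add: weight_sum_def)
next
  case (insert q Q)
  let ?U = "\<Union>q\<in>Q. E q"
  have "weight_sum w F (E q \<union> ?U) = weight_sum w F (E q) + weight_sum w F ?U - weight_sum w F (E q \<inter> ?U)"
    unfolding weight_sum_def using insert by (intro sum_Un) auto
  then have "weight_sum w F (E q \<union> ?U) \<le> weight_sum w F (E q) + weight_sum w F ?U"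
    using weight_sum_nonneg[of w F "E q \<inter> ?U"] w by simp
  also have "\<dots> \<le> weight_sum w F (E q) + (\<Sum>q\<in>Q. weight_sum w F (E q))"
    using insert by simp
  finally show ?case using insert by simp
qed

text \<open>
  The positions near the cut \<open>c\<close>, relative to \<open>c\<close>, that are hit from the left of the cut.
\<close>

definition occupied :: "int \<Rightarrow> (int \<Rightarrow> int) \<Rightarrow> int \<Rightarrow> int set" where
  "occupied d x c = {t \<in> {-d..<d}. \<exists>s. 0 \<le> s \<and> s < c \<and> s + x s = c + t}"

context weighted_shifts
begin

text \<open>Values are taken in \<open>A\<close> and not reduced modulo \<open>n\<close>: congruent
  elements of \<open>A\<close> count separately, which matches the coefficients of
  \<open>mod_proj n f\<close> as sums over fibres.\<close>

definition cyclic_injections :: "nat \<Rightarrow> (int \<Rightarrow> int) set" where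
  "cyclic_injections n =
    {y \<in> {0..<int n} \<rightarrow>\<^sub>E A. inj_on (\<lambda>s. (s + y s) mod int n) {0..<int n}}"

definition T :: "nat \<Rightarrow> real" where
  "T n = weight_sum w {0..<int n} (cyclic_injections n)"

lemma finite_cyclic_injections: "finite (cyclic_injections n)"
  unfolding cyclic_injections_def by (simp add: finite_PiE A_finite)

lemma T_nonneg: "0 \<le> T n"
  unfolding T_def by (rule weight_sum_nonneg) (rule w_nonneg)

text \<open>Only covering needs an argument. Injectivity modulo \<open>n\<close> makes every residue
  hit, so the residue of \<open>t\<close> is hit from some \<open>s\<close>. If all
  \<open>t - a\<close> lie in the interval, then \<open>t - y s\<close> lies there and is congruent
  to \<open>s\<close>, hence equal to it.\<close>

lemma T_le_P:
  assumes "0 < n"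
  shows "T n \<le> P {0..<int n}"
  unfolding T_def P_def
proof (intro weight_sum_mono w_nonneg finite_restricted_injections A_finite subsetI)
  fix y assume "y \<in> cyclic_injections n"
  then have y: "y \<in> {0..<int n} \<rightarrow>\<^sub>E A" and inj: "inj_on (\<lambda>s. (s + y s) mod int n) {0..<int n}"
    by (auto simp: cyclic_injections_def)
  have "inj_on (\<lambda>s. s + y s) {0..<int n}"
  proof (rule inj_onI)
    fix s t assume "s \<in> {0..<int n}" "t \<in> {0..<int n}" "s + y s = t + y t"
    then show "s = t" using inj_onD[OF inj, of s t] by simp
  qed
  moreover have "t \<in> (\<lambda>s. s + y s) ` {0..<int n}" if t: "\<forall>a\<in>A. t - a \<in> {0..<int n}" for t
  proof -
    have "(\<lambda>s. (s + y s) mod int n) ` {0..<int n} = {0..<int n}"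
      using inj assms by (intro endo_inj_surj) auto
    moreover have "t mod int n \<in> {0..<int n}" using assms by simp
    ultimately obtain s where s: "s \<in> {0..<int n}" "(s + y s) mod int n = t mod int n"
      by (metis (no_types, lifting) imageE)
    have "(t - y s) mod int n = s mod int n"
      using s(2) by (metis add_diff_cancel_right' mod_diff_left_eq)
    moreover have "t - y s \<in> {0..<int n}" using t s(1) y by auto
    ultimately have "t - y s = s" using s(1) by simp
    then show ?thesis using s(1) by (auto simp: image_iff intro!: bexI[of _ s])
  qed
  ultimately show "y \<in> restricted_injections integer_group A {0..<int n}"
    using y unfolding mem_restricted_injections_integer_group by blast
qed simp

text \<open>
  A collision modulo \<open>n\<close> between two points of the window comes from images that differ by exactly
  \<open>n\<close>; equality of the two patterns moves the upper one to the lower cut, where it contradicts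
  injectivity.
\<close>

lemma inj_on_mod_of_occupied_eq:
  assumes x: "x \<in> restricted_injections integer_group A {0..<M}"
    and c: "0 \<le> c" "c + int n \<le> M" and n: "2 * d < int n"
    and occ: "occupied d x c = occupied d x (c + int n)"
  shows "inj_on (\<lambda>s. (s + x s) mod int n) {c..<c + int n}"
proof -
  have inj: "inj_on (\<lambda>s. s + x s) {0..<M}" and xA: "\<And>s. 0 \<le> s \<Longrightarrow> s < M \<Longrightarrow> x s \<in> A"
    using x by (auto simp: mem_restricted_injections_integer_group PiE_def Pi_def)
  have *: "s + x s \<le> t + x t"
    if s: "s \<in> {c..<c + int n}" and t: "t \<in> {c..<c + int n}"
      and eq: "(s + x s) mod int n = (t + x t) mod int n" for s t
  proof (rule ccontr)
    assume "\<not> s + x s \<le> t + x t"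
    moreover have "int n dvd (s + x s) - (t + x t)"
      using eq by (simp only: mod_eq_dvd_iff)
    then obtain k where k: "(s + x s) - (t + x t) = int n * k" by (elim dvdE)
    ultimately have "0 < int n * k" by linarith
    then have "0 < k" using n d_nonneg by (simp add: zero_less_mult_iff)
    have st: "0 \<le> s" "s < c + int n" "c \<le> s" "0 \<le> t" "t < c + int n" "c \<le> t"
      using s t c by auto
    then have "x s \<in> A" "x t \<in> A"
      using c by (intro xA; linarith)+
    then have bd: "- d \<le> x s" "x s \<le> d" "- d \<le> x t" "x t \<le> d"
      by (auto dest: A_bound)
    \<comment> \<open>Two points of the window differ by less than \<open>n\<close>, and the
      displacements add at most \<open>2 * d < n\<close>. So the multiple of \<open>n\<close> is
      \<open>n\<close> itself.\<close>
    have "(s + x s) - (t + x t) < int n * 2" using bd st n by linarith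
    then have "int n * k < int n * 2" unfolding k .
    then have "k < 2" using n d_nonneg by (simp only: mult_less_cancel_left_pos)
    then have "k = 1" using \<open>0 < k\<close> by simp
    define u where "u = t + x t - c"
    have su: "s + x s = (c + int n) + u"
      using k \<open>k = 1\<close> by (simp add: u_def)
    \<comment> \<open>The lower bound comes from \<open>c \<le> t\<close>, the strict upper bound
      from \<open>s < c + n\<close>; hence the half-open range in \<open>occupied\<close>.\<close>
    have "- d \<le> u" "u < d"
      using st bd su unfolding u_def by linarith+
    then have "u \<in> occupied d x (c + int n)"
      using su st by (auto simp: occupied_def)
    then have "u \<in> occupied d x c"
      unfolding occ .
    then obtain r where r: "0 \<le> r" "r < c" "r + x r = c + u"
      by (auto simp: occupied_def)
    have "r = t"
    proof (rule inj_onD[OF inj])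
      show "r + x r = t + x t" using r(3) by (simp add: u_def)
      show "r \<in> {0..<M}" "t \<in> {0..<M}" using r st c by auto
    qed
    then show False using r st by simp
  qed
  show ?thesis
  proof (rule inj_onI)
    fix s t assume st: "s \<in> {c..<c + int n}" "t \<in> {c..<c + int n}"
      and eq: "(s + x s) mod int n = (t + x t) mod int n"
    have "s + x s = t + x t" using *[OF st eq] *[OF st(2,1) eq[symmetric]] by simp
    then show "s = t"
    proof (rule inj_onD[OF inj])
      show "s \<in> {0..<M}" "t \<in> {0..<M}" using st c by auto
    qed
  qed
qed

text \<open>Cut at \<open>c\<close> and \<open>c + n\<close>. The outer pieces restrict to
  restricted injections, while the middle piece closes up to a cyclic injection because the patterns
  at its two ends agree.\<close>

lemma weight_sum_le_of_occupied_eq: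
  assumes E: "E \<subseteq> restricted_injections integer_group A {0..<M}"
    and c: "0 \<le> c" "c + int n \<le> M" and n: "2 * d < int n"
    and occ: "\<And>x. x \<in> E \<Longrightarrow> occupied d x c = occupied d x (c + int n)"
  shows "weight_sum w {0..<M} E \<le> P {0..<c} * (T n * P {0..<M - (c + int n)})"
proof -
  define F1 F2 F3 where "F1 = {0..<c}" and "F2 = {c..<c + int n}" and "F3 = {c + int n..<M}"
  define S2 where "S2 = {z \<in> F2 \<rightarrow>\<^sub>E A. inj_on (\<lambda>s. (s + z s) mod int n) F2}"
  define S3 where "S3 = restricted_injections integer_group A F3"
  \<comment> \<open>An intermediate set that lets the splitting into two pieces be applied
    twice.\<close>
  define S23 where "S23 = {z \<in> F2 \<union> F3 \<rightarrow>\<^sub>E A. restrict z F2 \<in> S2 \<and> restrict z F3 \<in> S3}"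
  have un: "{0..<M} = F1 \<union> (F2 \<union> F3)" using c by (auto simp: F1_def F2_def F3_def)
  have fin: "finite F1" "finite F2" "finite F3" by (auto simp: F1_def F2_def F3_def)
  have disj: "F1 \<inter> (F2 \<union> F3) = {}" "F2 \<inter> F3 = {}" using c by (auto simp: F1_def F2_def F3_def)
  have finS: "finite S2" "finite S3" "finite S23"
    using fin A_finite by (auto simp: S2_def S3_def S23_def finite_PiE finite_restricted_injections)
  have "weight_sum w {0..<M} E \<le> P F1 * weight_sum w (F2 \<union> F3) S23"
    unfolding un P_def
  proof (intro weight_sum_Un_le w_nonneg disj finite_UnI fin finite_restricted_injections A_finite finS)
    fix x assume "x \<in> E"
    then have x: "x \<in> restricted_injections integer_group A {0..<M}" using E by auto
    then show "restrict x F1 \<in> restricted_injections integer_group A F1"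
      using un by (intro restrict_restricted_injections) auto
    have xA: "x \<in> {0..<M} \<rightarrow>\<^sub>E A"
      using x by (simp add: mem_restricted_injections_integer_group)
    have restrict_parts: "restrict (restrict x (F2 \<union> F3)) F2 = restrict x F2" "restrict (restrict x (F2 \<union> F3)) F3 = restrict x F3"
      by (simp_all add: Int_absorb1 Un_upper1 Un_upper2 Int_commute)
    have "inj_on (\<lambda>s. (s + restrict x F2 s) mod int n) F2"
      using inj_on_mod_of_occupied_eq[OF x c n occ[OF \<open>x \<in> E\<close>]]
      by (auto simp: inj_on_def F2_def)
    then have "restrict x F2 \<in> S2"
      using xA un unfolding S2_def by auto
    moreover have "restrict x F3 \<in> S3"
      unfolding S3_def using x un by (intro restrict_restricted_injections) auto
    moreover have "restrict x (F2 \<union> F3) \<in> F2 \<union> F3 \<rightarrow>\<^sub>E A"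
      using xA un by auto
    ultimately show "restrict x (F2 \<union> F3) \<in> S23"
      unfolding S23_def mem_Collect_eq restrict_parts by blast
  next
    show "E \<subseteq> extensional (F1 \<union> (F2 \<union> F3))"
      using E restricted_injections_extensional unfolding un by blast
  qed
  also have "weight_sum w (F2 \<union> F3) S23 \<le> weight_sum w F2 S2 * P F3"
    unfolding P_def S3_def[symmetric]
    by (intro weight_sum_Un_le w_nonneg disj fin finS) (auto simp: S23_def PiE_def)
  also have "weight_sum w F2 S2 \<le> T n"
  proof -
    have F2: "F2 = (\<lambda>s. s + c) ` {0..<int n}" by (simp add: F2_def add.commute)
    show ?thesis unfolding F2 T_def
    proof (intro weight_sum_shift_le w_nonneg finite_cyclic_injections)
      fix z assume "z \<in> S2"
      then have z: "z \<in> F2 \<rightarrow>\<^sub>E A" and inj: "inj_on (\<lambda>s. (s + z s) mod int n) F2"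
        by (auto simp: S2_def)
      have "inj_on (\<lambda>s. (s + (\<lambda>s\<in>{0..<int n}. z (s + c)) s) mod int n) {0..<int n}"
      proof (rule inj_onI)
        fix s t assume st: "s \<in> {0..<int n}" "t \<in> {0..<int n}"
          and "(s + (\<lambda>s\<in>{0..<int n}. z (s + c)) s) mod int n = (t + (\<lambda>s\<in>{0..<int n}. z (s + c)) t) mod int n"
        then have "(s + z (s + c)) mod int n = (t + z (t + c)) mod int n" by simp
        then have "((s + z (s + c)) + c) mod int n = ((t + z (t + c)) + c) mod int n"
          by (metis mod_add_left_eq)
        then have "((s + c) + z (s + c)) mod int n = ((t + c) + z (t + c)) mod int n"
          by (simp add: algebra_simps)
        then show "s = t" using inj_onD[OF inj, of "s + c" "t + c"] st by (auto simp: F2_def)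
      qed
      moreover have "(\<lambda>s\<in>{0..<int n}. z (s + c)) \<in> {0..<int n} \<rightarrow>\<^sub>E A"
        using z unfolding F2 by auto
      ultimately show "(\<lambda>s\<in>{0..<int n}. z (s + c)) \<in> cyclic_injections n"
        unfolding cyclic_injections_def by blast
    qed (auto simp: S2_def PiE_def F2)
  qed
  also have "P F3 = P {0..<M - (c + int n)}"
    unfolding F3_def by (rule P_interval)
  finally show ?thesis
    unfolding F1_def by (simp add: mult_left_mono mult_right_mono P_nonneg)
qed

text \<open>
  Among the \<open>N + 1\<close> cuts at multiples of \<open>m\<close>, two carry the same one of the \<open>N\<close> patterns.
\<close>

lemma P_le_cyclic_decomposition:
  assumes m: "2 * d < int m" and N: "N = 2 ^ nat (2 * d)"
  shows "P {0..<int (N * m)} \<le> (\<Sum>(a, b)\<in>{(a, b). a < b \<and> b \<le> N}.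
    P {0..<int (a * m)} * (T ((b - a) * m) * P {0..<int ((N - b) * m)}))"
proof -
  define Q where "Q = {(a, b). a < b \<and> b \<le> N}"
  define X where "X = restricted_injections integer_group A {0..<int (N * m)}"
  define E where "E = (\<lambda>(a, b). {x \<in> X. occupied d x (int (a * m)) = occupied d x (int (b * m))})"
  have "Q \<subseteq> {..N} \<times> {..N}" by (auto simp: Q_def)
  then have Q: "finite Q" by (rule finite_subset) auto
  have X: "finite X" unfolding X_def using A_finite by (intro finite_restricted_injections) auto
  have "X = (\<Union>q\<in>Q. E q)"
  proof
    show "X \<subseteq> (\<Union>q\<in>Q. E q)"
    proof
      fix x assume "x \<in> X"
      have "\<not> inj_on (\<lambda>a. occupied d x (int (a * m))) {..N}"
      proof
        assume "inj_on (\<lambda>a. occupied d x (int (a * m))) {..N}"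
        then have "card {..N} \<le> card (Pow {-d..<d})"
          by (rule card_inj_on_le) (auto simp: occupied_def)
        then show False by (simp add: card_Pow N)
      qed
      then obtain a b where "a \<le> N" "b \<le> N" "a \<noteq> b"
          and eq: "occupied d x (int (a * m)) = occupied d x (int (b * m))"
        by (auto simp: inj_on_def)
      then have "(min a b, max a b) \<in> Q" "x \<in> E (min a b, max a b)"
        using \<open>x \<in> X\<close> by (auto simp: Q_def E_def min_def max_def)
      then show "x \<in> (\<Union>q\<in>Q. E q)" by blast
    qed
  qed (auto simp: E_def)
  then have "P {0..<int (N * m)} = weight_sum w {0..<int (N * m)} (\<Union>q\<in>Q. E q)"
    by (simp add: P_def X_def)
  also have "\<dots> \<le> (\<Sum>q\<in>Q. weight_sum w {0..<int (N * m)} (E q))"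
    using Q X by (intro weight_sum_UN_le w_nonneg) (auto simp: E_def)
  also have "\<dots> \<le> (\<Sum>(a, b)\<in>Q. P {0..<int (a * m)} * (T ((b - a) * m) * P {0..<int ((N - b) * m)}))"
  proof (rule sum_mono)
    fix q assume "q \<in> Q"
    then obtain a b where q: "q = (a, b)" "a < b" "b \<le> N" by (auto simp: Q_def)
    have bm: "int (a * m) + int ((b - a) * m) = int (b * m)"
      using q(2) by (simp add: of_nat_diff algebra_simps)
    have Nm: "int (N * m) - int (b * m) = int ((N - b) * m)"
      using q(3) by (simp add: of_nat_diff algebra_simps)
    have "1 * int m \<le> int (b - a) * int m" using q(2) by (intro mult_right_mono) auto
    then have "2 * d < int ((b - a) * m)" using m by simp
    moreover have "int (b * m) \<le> int (N * m)" using q(3) by (simp add: mult_right_mono)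
    ultimately have "weight_sum w {0..<int (N * m)} (E q)
      \<le> P {0..<int (a * m)} * (T ((b - a) * m) * P {0..<int (N * m) - (int (a * m) + int ((b - a) * m))})"
      by (intro weight_sum_le_of_occupied_eq) (auto simp: E_def X_def q(1) bm simp del: of_nat_mult)
    then show "weight_sum w {0..<int (N * m)} (E q)
      \<le> (case q of (a, b) \<Rightarrow> P {0..<int (a * m)} * (T ((b - a) * m) * P {0..<int ((N - b) * m)}))"
      unfolding bm Nm q(1) by simp
  qed
  finally show ?thesis unfolding Q_def .
qed

end

subsection \<open>Permanents over finite groups\<close>

text \<open>Together with the next lemma this moves all estimates from extended reals to
  exponentials. At \<open>p = 0\<close> both sides hold here, and both fail in the next
  lemma.\<close>

lemma log_ext_div_less_iff:
  assumes "0 \<le> p" "0 < k"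
  shows "log_ext p / ereal (real k) < ereal r \<longleftrightarrow> p < exp (r * real k)"
proof (cases "p = 0")
  case False
  then have "0 < p" using assms by simp
  have "ln p / real k < r \<longleftrightarrow> ln p < r * real k"
    using assms by (simp add: pos_divide_less_eq)
  also have "\<dots> \<longleftrightarrow> p < exp (r * real k)"
    using \<open>0 < p\<close> by (metis exp_less_cancel_iff exp_ln)
  finally show ?thesis using False assms by (simp add: log_ext_def)
qed (use assms in \<open>simp add: log_ext_def\<close>)

lemma less_log_ext_div_iff:
  assumes "0 \<le> p" "0 < k"
  shows "ereal r < log_ext p / ereal (real k) \<longleftrightarrow> exp (r * real k) < p"
proof (cases "p = 0")
  case False
  then have "0 < p" using assms by simp
  have "r < ln p / real k \<longleftrightarrow> r * real k < ln p"
    using assms by (simp add: pos_less_divide_eq)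
  also have "\<dots> \<longleftrightarrow> exp (r * real k) < p"
    using \<open>0 < p\<close> by (metis exp_less_cancel_iff exp_ln)
  finally show ?thesis using False assms by (simp add: log_ext_def)
qed (use assms in \<open>simp add: log_ext_def\<close>)

text \<open>An injective self-map of a finite set is onto, so covering is automatic.\<close>

lemma mem_restricted_injections_finite:
  assumes "group G" "finite (carrier G)" "A \<subseteq> carrier G"
  shows "x \<in> restricted_injections G A (carrier G) \<longleftrightarrow>
    x \<in> carrier G \<rightarrow>\<^sub>E A \<and> inj_on (\<lambda>s. s \<otimes>\<^bsub>G\<^esub> x s) (carrier G)"
proof -
  interpret group G by fact
  have "(\<lambda>s. s \<otimes>\<^bsub>G\<^esub> x s) ` carrier G = carrier G"
    if "x \<in> carrier G \<rightarrow>\<^sub>E A" "inj_on (\<lambda>s. s \<otimes>\<^bsub>G\<^esub> x s) (carrier G)"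
    using that assms by (intro endo_inj_surj) (auto simp: PiE_iff subset_iff)
  then show ?thesis by (auto simp: restricted_injections_def)
qed

text \<open>The whole group satisfies every Folner condition, so it determines the limit.
  Conversely, taking \<open>K\<close> to be the whole group and \<open>1 / card (carrier G)\<close>
  as the tolerance forces the symmetric difference to be empty, so only the whole group
  remains.\<close>

lemma has_folner_limit_finite_iff:
  assumes "group G" "finite (carrier G)"
  shows "has_folner_limit G \<phi> L \<longleftrightarrow> L = \<phi> (carrier G)"
proof -
  interpret group G by fact
  have absorb: "F <#>\<^bsub>G\<^esub> carrier G = carrier G" "carrier G <#>\<^bsub>G\<^esub> F = carrier G"
    if F: "F \<subseteq> carrier G" "F \<noteq> {}" for F
  proof -
    obtain k where k: "k \<in> F" "k \<in> carrier G" using F by blast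
    have left: "g \<in> F <#>\<^bsub>G\<^esub> carrier G" if "g \<in> carrier G" for g
    proof -
      have "g = k \<otimes>\<^bsub>G\<^esub> (inv\<^bsub>G\<^esub> k \<otimes>\<^bsub>G\<^esub> g)"
        using k that m_assoc[of k "inv\<^bsub>G\<^esub> k" g] by simp
      moreover have "inv\<^bsub>G\<^esub> k \<otimes>\<^bsub>G\<^esub> g \<in> carrier G" using k that by simp
      ultimately show ?thesis using k(1) unfolding set_mult_def by blast
    qed
    have right: "g \<in> carrier G <#>\<^bsub>G\<^esub> F" if "g \<in> carrier G" for g
    proof -
      have "g = (g \<otimes>\<^bsub>G\<^esub> inv\<^bsub>G\<^esub> k) \<otimes>\<^bsub>G\<^esub> k"
        using k that m_assoc[of g "inv\<^bsub>G\<^esub> k" k] by simp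
      moreover have "g \<otimes>\<^bsub>G\<^esub> inv\<^bsub>G\<^esub> k \<in> carrier G" using k that by simp
      ultimately show ?thesis using k(1) unfolding set_mult_def by blast
    qed
    have "F <#>\<^bsub>G\<^esub> carrier G \<subseteq> carrier G" "carrier G <#>\<^bsub>G\<^esub> F \<subseteq> carrier G"
      using F(1) by (intro set_mult_closed; simp)+
    then show "F <#>\<^bsub>G\<^esub> carrier G = carrier G" "carrier G <#>\<^bsub>G\<^esub> F = carrier G"
      using left right by blast+
  qed
  have carrier: "carrier G \<in> nonempty_finite_subsets G" and pos: "0 < card (carrier G)"
    using assms by (auto simp: nonempty_finite_subsets_def card_gt_0_iff)
  show ?thesis
  proof
    assume lim: "has_folner_limit G \<phi> L"
    show "L = \<phi> (carrier G)"
    proof (rule ccontr)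
      assume "L \<noteq> \<phi> (carrier G)"
      then have "open (- {\<phi> (carrier G)}) \<and> L \<in> - {\<phi> (carrier G)}" by auto
      then obtain K and \<delta> :: real where "K \<in> nonempty_finite_subsets G" "0 < \<delta>"
        and *: "\<forall>F \<in> nonempty_finite_subsets G.
          real (card (sym_diff (F <#>\<^bsub>G\<^esub> K) F)) < \<delta> * real (card F) \<longrightarrow> \<phi> F \<in> - {\<phi> (carrier G)}"
        using lim unfolding has_folner_limit_def by meson
      then have "carrier G <#>\<^bsub>G\<^esub> K = carrier G"
        by (intro absorb) (auto simp: nonempty_finite_subsets_def)
      then show False using bspec[OF * carrier] \<open>0 < \<delta>\<close> pos by simp
    qed
  next
    assume L: "L = \<phi> (carrier G)"
    show "has_folner_limit G \<phi> L"
      unfolding has_folner_limit_def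
    proof (intro allI impI bexI[OF _ carrier] exI conjI ballI)
      fix U F assume U: "open U \<and> L \<in> U" and F: "F \<in> nonempty_finite_subsets G"
        and small: "real (card (sym_diff (F <#>\<^bsub>G\<^esub> carrier G) F)) < 1 / real (card (carrier G)) * real (card F)"
      have F: "F \<subseteq> carrier G" "F \<noteq> {}" using F by (auto simp: nonempty_finite_subsets_def)
      have "1 / real (card (carrier G)) * real (card F) \<le> 1"
        using pos card_mono[OF assms(2) F(1)] by (simp add: divide_simps)
      then have "card (sym_diff (F <#>\<^bsub>G\<^esub> carrier G) F) = 0"
        using small by linarith
      moreover have "finite (sym_diff (carrier G) F)"
        using F(1) assms(2) by (auto intro: finite_subset)
      ultimately have "sym_diff (carrier G) F = {}"
        unfolding absorb(1)[OF F] by (simp only: card_eq_0_iff) blast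
      then have "F = carrier G" by blast
      then show "\<phi> F \<in> U" using U L by simp
    qed (use pos in simp)
  qed
qed

text \<open>Enlarging \<open>A\<close> does not change the sum: a function with a value outside
  \<open>A\<close> has weight zero because \<open>f\<close> vanishes there.\<close>

lemma per_finite:
  assumes "group G" "finite (carrier G)" "Poly_Mapping.keys f \<subseteq> carrier G"
  shows "per G f = local_per G (carrier G) f (carrier G)"
proof -
  interpret group G by fact
  let ?L = "local_per G (carrier G) f (carrier G)"
  have indep: "local_per G A f (carrier G) = ?L"
    if A: "A \<in> nonempty_finite_subsets G" "Poly_Mapping.keys f \<subseteq> A" for A
  proof -
    have sub: "A \<subseteq> carrier G" using A by (simp add: nonempty_finite_subsets_def)
    have "(\<Sum>x\<in>restricted_injections G A (carrier G). \<Prod>s\<in>carrier G. Poly_Mapping.lookup f (x s))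
      = (\<Sum>x\<in>restricted_injections G (carrier G) (carrier G). \<Prod>s\<in>carrier G. Poly_Mapping.lookup f (x s))"
    proof (rule sum.mono_neutral_left)
      show "finite (restricted_injections G (carrier G) (carrier G))"
        using assms by (simp add: finite_restricted_injections)
      show "restricted_injections G A (carrier G) \<subseteq> restricted_injections G (carrier G) (carrier G)"
      proof
        fix x assume "x \<in> restricted_injections G A (carrier G)"
        then show "x \<in> restricted_injections G (carrier G) (carrier G)"
          unfolding mem_restricted_injections_finite[OF assms(1,2) sub]
            mem_restricted_injections_finite[OF assms(1,2) order_refl]
          using PiE_mono[of "carrier G" "\<lambda>_. A" "\<lambda>_. carrier G"] sub by blast
      qed
      show "\<forall>x\<in>restricted_injections G (carrier G) (carrier G) - restricted_injections G A (carrier G).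
          (\<Prod>s\<in>carrier G. Poly_Mapping.lookup f (x s)) = 0"
      proof
        fix x assume x: "x \<in> restricted_injections G (carrier G) (carrier G) - restricted_injections G A (carrier G)"
        then obtain s where "s \<in> carrier G" "x s \<notin> A"
          using sub assms by (auto simp: mem_restricted_injections_finite PiE_iff)
        then show "(\<Prod>s\<in>carrier G. Poly_Mapping.lookup f (x s)) = 0"
          using assms(2) A(2) by (intro prod_zero bexI[of _ s]) (auto simp: in_keys_iff)
      qed
    qed
    then show ?thesis by (simp add: local_per_def)
  qed
  have carrier: "carrier G \<in> nonempty_finite_subsets G"
    using assms by (auto simp: nonempty_finite_subsets_def)
  have "0 < card (carrier G)" using assms(2) by (auto simp: card_gt_0_iff)
  then have "?L < \<infinity>" by (auto simp: local_per_def log_ext_def)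
  show ?thesis
    unfolding per_def has_folner_limit_finite_iff[OF assms(1,2)]
  proof (rule the_equality)
    show "?L < \<infinity> \<and> (\<forall>A\<in>nonempty_finite_subsets G. Poly_Mapping.keys f \<subseteq> A \<longrightarrow>
        ?L = local_per G A f (carrier G))"
      using \<open>?L < \<infinity>\<close> indep[symmetric] by blast
  qed (use carrier assms(3) in blast)
qed

lemma lookup_mod_proj:
  assumes "finite A" "Poly_Mapping.keys f \<subseteq> A"
  shows "Poly_Mapping.lookup (mod_proj n f) t
    = (\<Sum>a | a \<in> A \<and> a mod int n = t. Poly_Mapping.lookup f a)"
proof -
  have "Poly_Mapping.lookup (mod_proj n f) t
      = (\<Sum>a\<in>Poly_Mapping.keys f. if a mod int n = t then Poly_Mapping.lookup f a else 0)"
    by (simp add: mod_proj_def group_ring_map_def lookup_sum lookup_single when_def)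
  also have "\<dots> = (\<Sum>a\<in>A. if a mod int n = t then Poly_Mapping.lookup f a else 0)"
    using assms by (intro sum.mono_neutral_left) (auto simp: in_keys_iff)
  also have "\<dots> = (\<Sum>a | a \<in> A \<and> a mod int n = t. Poly_Mapping.lookup f a)"
    using assms by (simp add: sum.inter_filter)
  finally show ?thesis .
qed

context weighted_shifts
begin

text \<open>Each coefficient of \<open>mod_proj n f\<close> is a sum over a residue class in
  \<open>A\<close>. Distributing the product over these sums enumerates the cyclic injections,
  grouped by their reduction \<open>?h\<close> modulo \<open>n\<close>; injectivity modulo
  \<open>n\<close> depends on that reduction only.\<close>

lemma per_integer_mod_group:
  assumes f: "Poly_Mapping.lookup f = w" "Poly_Mapping.keys f \<subseteq> A" and n: "0 < n"
  shows "per (integer_mod_group n) (mod_proj n f) = log_ext (T n) / ereal (real n)"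
proof -
  let ?C = "{0..<int n}"
  let ?R = "restricted_injections (integer_mod_group n) ?C ?C"
  let ?B = "\<lambda>t. {a \<in> A. a mod int n = t}"
  let ?h = "\<lambda>y. \<lambda>s\<in>?C. y s mod int n"
  have carrier: "carrier (integer_mod_group n) = ?C"
    using n by (simp add: carrier_integer_mod_group)
  have R: "x \<in> ?R \<longleftrightarrow> x \<in> ?C \<rightarrow>\<^sub>E ?C \<and> inj_on (\<lambda>s. (s + x s) mod int n) ?C" for x
    using mem_restricted_injections_finite[of "integer_mod_group n" ?C x] carrier by simp
  have keys: "Poly_Mapping.keys (mod_proj n f) \<subseteq> ?C"
  proof
    fix t assume "t \<in> Poly_Mapping.keys (mod_proj n f)"
    then have "(\<Sum>a\<in>?B t. Poly_Mapping.lookup f a) \<noteq> 0"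
      by (simp add: in_keys_iff lookup_mod_proj[OF A_finite f(2)])
    then have "?B t \<noteq> {}" by (metis sum.empty)
    then show "t \<in> ?C" using n by auto
  qed
  have hmod: "inj_on (\<lambda>s. (s + ?h y s) mod int n) ?C \<longleftrightarrow> inj_on (\<lambda>s. (s + y s) mod int n) ?C" for y
    by (intro inj_on_cong) (simp add: mod_add_right_eq)
  have fibre: "{y \<in> cyclic_injections n. ?h y = x} = PiE ?C (\<lambda>s. ?B (x s))" if x: "x \<in> ?R" for x
  proof (intro equalityI subsetI)
    fix y assume "y \<in> {y \<in> cyclic_injections n. ?h y = x}"
    then show "y \<in> PiE ?C (\<lambda>s. ?B (x s))"
      by (auto simp: cyclic_injections_def PiE_iff)
  next
    fix y assume y: "y \<in> PiE ?C (\<lambda>s. ?B (x s))"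
    have "?h y = x"
      using x y unfolding R by (intro extensionalityI[of _ ?C]) (auto simp: PiE_iff)
    moreover have "y \<in> cyclic_injections n"
      using x y hmod[of y] unfolding R \<open>?h y = x\<close> by (auto simp: cyclic_injections_def PiE_iff)
    ultimately show "y \<in> {y \<in> cyclic_injections n. ?h y = x}" by simp
  qed
  have "(\<Sum>x\<in>?R. \<Prod>s\<in>?C. Poly_Mapping.lookup (mod_proj n f) (x s))
      = (\<Sum>x\<in>?R. \<Prod>s\<in>?C. \<Sum>a\<in>?B (x s). w a)"
    by (simp add: lookup_mod_proj[OF A_finite f(2)] f(1))
  also have "\<dots> = (\<Sum>x\<in>?R. \<Sum>y\<in>PiE ?C (\<lambda>s. ?B (x s)). \<Prod>s\<in>?C. w (y s))"
    using A_finite by (intro sum.cong refl prod_sum_PiE) auto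
  also have "\<dots> = (\<Sum>x\<in>?R. \<Sum>y\<in>{y \<in> cyclic_injections n. ?h y = x}. \<Prod>s\<in>?C. w (y s))"
    using fibre by (intro sum.cong refl) auto
  also have "\<dots> = (\<Sum>y\<in>cyclic_injections n. \<Prod>s\<in>?C. w (y s))"
  proof (rule sum.group)
    show "?h ` cyclic_injections n \<subseteq> ?R"
    proof
      fix x assume "x \<in> ?h ` cyclic_injections n"
      then obtain y where y: "y \<in> cyclic_injections n" "x = ?h y" by blast
      then show "x \<in> ?R"
        using hmod[of y] n unfolding R y(2) by (auto simp: cyclic_injections_def)
    qed
  qed (auto simp: finite_cyclic_injections finite_restricted_injections)
  also have "\<dots> = T n" by (simp add: T_def weight_sum_def)
  finally show ?thesis
    using per_finite[of "integer_mod_group n" "mod_proj n f"] keys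
    by (simp add: carrier local_per_def)
qed

end

subsection \<open>The permanent over the integers\<close>

lemma mem_set_mult_integer_group:
  "t \<in> F <#>\<^bsub>integer_group\<^esub> K \<longleftrightarrow> (\<exists>k\<in>K. t - k \<in> F)"
proof
  assume "\<exists>k\<in>K. t - k \<in> F"
  then obtain k where k: "k \<in> K" "t - k \<in> F" by blast
  then have "(t - k) + k \<in> F <#>\<^bsub>integer_group\<^esub> K"
    unfolding set_mult_def mult_integer_group by blast
  then show "t \<in> F <#>\<^bsub>integer_group\<^esub> K" by simp
qed (auto simp: set_mult_def intro: bexI[rotated])

lemma sym_diff_set_mult_eq_collar:
  assumes "0 \<le> L"
  shows "sym_diff (F <#>\<^bsub>integer_group\<^esub> {-L..L}) F = collar L F"
proof -
  have iff: "t \<in> F <#>\<^bsub>integer_group\<^esub> {-L..L} \<longleftrightarrow> (\<exists>s\<in>F. \<bar>t - s\<bar> \<le> L)" for t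
  proof
    assume "\<exists>s\<in>F. \<bar>t - s\<bar> \<le> L"
    then obtain s where "s \<in> F" "\<bar>t - s\<bar> \<le> L" by blast
    then have "t - s \<in> {-L..L}" "t - (t - s) \<in> F" by auto
    then show "t \<in> F <#>\<^bsub>integer_group\<^esub> {-L..L}"
      unfolding mem_set_mult_integer_group by blast
  next
    assume "t \<in> F <#>\<^bsub>integer_group\<^esub> {-L..L}"
    then obtain k where "k \<in> {-L..L}" "t - k \<in> F"
      unfolding mem_set_mult_integer_group by blast
    then show "\<exists>s\<in>F. \<bar>t - s\<bar> \<le> L" by (intro bexI[of _ "t - k"]) auto
  qed
  have "F \<subseteq> F <#>\<^bsub>integer_group\<^esub> {-L..L}"
    unfolding subset_iff iff using assms by (auto intro: bexI[rotated])
  then show ?thesis unfolding collar_def iff[symmetric] by blast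
qed

text \<open>Only points near the two ends contribute, at most \<open>4 * L\<close> of them for every
  \<open>n\<close>.\<close>

lemma integer_group_folner_interval:
  assumes K: "K \<in> nonempty_finite_subsets integer_group" and \<delta>: "0 < \<delta>"
  shows "\<forall>\<^sub>F n in sequentially.
    real (card (sym_diff ({0..<int n} <#>\<^bsub>integer_group\<^esub> K) {0..<int n})) < \<delta> * real n"
proof -
  define L where "L = Max (abs ` K)"
  have "finite K" "K \<noteq> {}" using K by (auto simp: nonempty_finite_subsets_def)
  then have L: "\<bar>k\<bar> \<le> L" if "k \<in> K" for k
    using that by (auto simp: L_def)
  then have "0 \<le> L" using \<open>K \<noteq> {}\<close> by fastforce
  have bound: "real (card (sym_diff ({0..<int n} <#>\<^bsub>integer_group\<^esub> K) {0..<int n})) \<le> 4 * real_of_int L" for n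
  proof -
    \<comment> \<open>\<open>K\<close> need not contain 0, so points of the interval may be lost as
      well. One fixed \<open>k\<close> already confines these to the ends.\<close>
    obtain k where k: "k \<in> K" using \<open>K \<noteq> {}\<close> by blast
    have "sym_diff ({0..<int n} <#>\<^bsub>integer_group\<^esub> K) {0..<int n} \<subseteq> {-L..<L} \<union> {int n - L..<int n + L}"
    proof
      fix t assume t: "t \<in> sym_diff ({0..<int n} <#>\<^bsub>integer_group\<^esub> K) {0..<int n}"
      show "t \<in> {-L..<L} \<union> {int n - L..<int n + L}"
      proof (cases "t \<in> {0..<int n}")
        case True
        then have "t \<notin> {0..<int n} <#>\<^bsub>integer_group\<^esub> K" using t by blast
        then have "t - k \<notin> {0..<int n}"
          using k unfolding mem_set_mult_integer_group by blast
        then show ?thesis using L[OF k] True by auto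
      next
        case False
        then have "t \<in> {0..<int n} <#>\<^bsub>integer_group\<^esub> K" using t by blast
        then obtain j where "j \<in> K" "t - j \<in> {0..<int n}"
          unfolding mem_set_mult_integer_group by blast
        then show ?thesis using False L[of j] by auto
      qed
    qed
    then have "card (sym_diff ({0..<int n} <#>\<^bsub>integer_group\<^esub> K) {0..<int n})
        \<le> card ({-L..<L} \<union> {int n - L..<int n + L})"
      by (intro card_mono) auto
    also have "\<dots> \<le> card {-L..<L} + card {int n - L..<int n + L}" by (rule card_Un_le)
    finally show ?thesis using \<open>0 \<le> L\<close> by simp
  qed
  obtain n0 where n0: "4 * real_of_int L / \<delta> < real n0" using reals_Archimedean2 by blast
  have "4 * real_of_int L < \<delta> * real n" if "n0 \<le> n" for n
  proof -
    have "4 * real_of_int L / \<delta> < real n" using n0 that by linarith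
    then show ?thesis using \<delta> by (simp add: pos_divide_less_eq mult.commute)
  qed
  then show ?thesis
    by (intro eventually_sequentiallyI[of n0]) (rule le_less_trans[OF bound])
qed

text \<open>Long intervals eventually meet every Folner condition, so two limits with disjoint
  neighbourhoods would be contradicted on a common interval.\<close>

lemma has_folner_limit_integer_group_unique:
  assumes "has_folner_limit integer_group \<phi> x" "has_folner_limit integer_group \<phi> y"
  shows "x = y"
proof (rule ccontr)
  assume "x \<noteq> y"
  then obtain U V where UV: "open U" "open V" "x \<in> U" "y \<in> V" "U \<inter> V = {}"
    using hausdorff[OF \<open>x \<noteq> y\<close>] by blast
  have ev: "\<forall>\<^sub>F n in sequentially. \<phi> {0..<int n} \<in> W"
    if lim: "has_folner_limit integer_group \<phi> z" and W: "open W" "z \<in> W" for z W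
  proof -
    obtain K and \<delta> :: real where K: "K \<in> nonempty_finite_subsets integer_group" "0 < \<delta>"
      and *: "\<forall>F \<in> nonempty_finite_subsets integer_group.
        real (card (sym_diff (F <#>\<^bsub>integer_group\<^esub> K) F)) < \<delta> * real (card F) \<longrightarrow> \<phi> F \<in> W"
      using lim[unfolded has_folner_limit_def, THEN spec, of W] W by blast
    show ?thesis
      using integer_group_folner_interval[OF K] eventually_gt_at_top[of 0]
    proof eventually_elim
      case (elim n)
      have "{0..<int n} \<in> nonempty_finite_subsets integer_group"
        using elim(2) by (auto simp: nonempty_finite_subsets_def)
      then show ?case using * elim(1) by auto
    qed
  qed
  have "\<forall>\<^sub>F n in sequentially. False"
    using ev[OF assms(1) UV(1,3)] ev[OF assms(2) UV(2,4)]
    by eventually_elim (use UV(5) in blast)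
  then show False by simp
qed

section \<open>The growth rate of intervals as a Folner limit\<close>

context weighted_shifts
begin

text \<open>With the infimum, a rate below \<open>growth\<close> bounds all intervals from below at
  once, and a rate above it is beaten by some single length.\<close>

definition growth :: ereal where
  "growth = (INF n\<in>{1..}. log_ext (P {0..<int n}) / ereal (real n))"

lemma growth_less_infinity: "growth < \<infinity>"
proof -
  have "growth \<le> log_ext (P {0..<int 1}) / ereal (real 1)"
    unfolding growth_def by (rule INF_lower) simp
  also have "\<dots> < \<infinity>" by (simp add: log_ext_def)
  finally show ?thesis .
qed

lemma interval_bound_of_less_growth:
  assumes "ereal q < growth"
  shows "exp (q * real n) \<le> P {0..<int n}"
proof (cases "n = 0")
  case False
  have "ereal q < log_ext (P {0..<int n}) / ereal (real n)"
    using less_INF_D[OF assms[unfolded growth_def], of n] False by simp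
  then show ?thesis using less_log_ext_div_iff[OF P_nonneg, of n] False by simp
qed (simp add: P_empty)

text \<open>Applied with \<open>c\<close> the size of a collar; the denominator \<open>K + 1\<close>
  allows \<open>K = 0\<close>.\<close>

lemma error_term_less:
  assumes "0 \<le> K" "0 < \<epsilon>" "0 < m" and c: "c < \<epsilon> / (K + 1) * m"
  shows "K * c < \<epsilon> * (m::real)"
proof -
  have "(K + 1) * c < \<epsilon> * m"
    using c assms(1) by (simp add: pos_less_divide_eq mult.commute)
  show ?thesis
  proof (cases "0 \<le> c")
    case True
    then show ?thesis using \<open>(K + 1) * c < \<epsilon> * m\<close> by (simp add: algebra_simps)
  next
    case False
    then have "K * c \<le> 0" using assms(1) by (simp add: mult_nonneg_nonpos)
    also have "0 < \<epsilon> * m" using assms by simp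
    finally show ?thesis .
  qed
qed

text \<open>Some single length \<open>n\<close> has rate below some \<open>q < r\<close>. Tiling by
  intervals of this length gives rate \<open>q\<close> up to a collar error, which the slack
  \<open>r - q\<close> absorbs.\<close>

lemma P_less_of_growth_less:
  assumes "growth < ereal r"
  shows "\<exists>L \<delta>. 0 \<le> L \<and> 0 < (\<delta>::real) \<and> (\<forall>F. finite F \<and> F \<noteq> {} \<and>
    real (card (collar L F)) < \<delta> * real (card F) \<longrightarrow> P F < exp (r * real (card F)))"
proof -
  obtain n where "1 \<le> n" "log_ext (P {0..<int n}) / ereal (real n) < ereal r"
    using assms unfolding growth_def INF_less_iff by auto
  then obtain q where q: "log_ext (P {0..<int n}) / ereal (real n) < ereal q" "q < r"
    using ereal_dense2 by (metis less_ereal.simps(1))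
  have n: "0 < n" using \<open>1 \<le> n\<close> by simp
  have Pn: "P {0..<int n} \<le> exp (q * real n)"
    using q(1) log_ext_div_less_iff[OF P_nonneg n] by simp
  define K where "K = (2 * real n + 1) * (\<bar>q\<bar> + ln C)"
  have K: "0 \<le> K" unfolding K_def using C_ge_1 by simp
  show ?thesis
  proof (intro exI conjI allI impI)
    show "0 < (r - q) / (K + 1)" using q(2) K by simp
    fix F assume F: "finite F \<and> F \<noteq> {} \<and> real (card (collar (int n) F)) < (r - q) / (K + 1) * real (card F)"
    then have "0 < real (card F)" by (simp add: card_gt_0_iff)
    then have "K * real (card (collar (int n) F)) < (r - q) * real (card F)"
      using F q(2) K by (intro error_term_less) auto
    then have "q * real (card F) + K * real (card (collar (int n) F)) < r * real (card F)"
      by (simp add: algebra_simps)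
    then show "P F < exp (r * real (card F))"
      using P_le_of_interval_bound[OF _ n Pn, of F] F unfolding K_def
      by (smt (verit) exp_less_cancel_iff)
  qed simp
qed

text \<open>Choose \<open>q\<close> strictly between \<open>r\<close> and \<open>growth\<close>. All
  intervals satisfy the lower bound at rate \<open>q\<close>, and the slack \<open>q - r\<close>
  absorbs the collar error.\<close>

lemma P_greater_of_less_growth:
  assumes "ereal r < growth"
  shows "\<exists>\<delta>. 0 < (\<delta>::real) \<and> (\<forall>F. finite F \<and> F \<noteq> {} \<and>
    real (card (collar (2 * d) F)) < \<delta> * real (card F) \<longrightarrow> exp (r * real (card F)) < P F)"
proof -
  obtain q where q: "r < q" "ereal q < growth"
    using ereal_dense2[OF assms] by auto
  define K where "K = \<bar>q\<bar> + ln C"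
  have K: "0 \<le> K" unfolding K_def using C_ge_1 by simp
  show ?thesis
  proof (intro exI conjI allI impI)
    show "0 < (q - r) / (K + 1)" using q(1) K by simp
    fix F assume F: "finite F \<and> F \<noteq> {} \<and> real (card (collar (2 * d) F)) < (q - r) / (K + 1) * real (card F)"
    then have "0 < real (card F)" by (simp add: card_gt_0_iff)
    then have "K * real (card (collar (2 * d) F)) < (q - r) * real (card F)"
      using F q(1) K by (intro error_term_less) auto
    then have "r * real (card F) < q * real (card F) - K * real (card (collar (2 * d) F))"
      by (simp add: algebra_simps)
    then show "exp (r * real (card F)) < P F"
      using P_ge_of_interval_bound[OF _ interval_bound_of_less_growth[OF q(2)], of F] F unfolding K_def
      by (smt (verit) exp_less_cancel_iff)
  qed
qed

lemma has_folner_limit_growth: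
  "has_folner_limit integer_group (\<lambda>F. log_ext (P F) / ereal (real (card F))) growth"
  unfolding has_folner_limit_def
proof (intro allI impI, elim conjE)
  fix U assume U: "open U" "growth \<in> U"
  have "\<exists>L \<delta>. 0 \<le> L \<and> 0 < (\<delta>::real) \<and> (\<forall>F. finite F \<and> F \<noteq> {} \<and>
    real (card (collar L F)) < \<delta> * real (card F) \<longrightarrow> log_ext (P F) / ereal (real (card F)) \<in> U)"
  proof (cases growth)
    case MInf
    \<comment> \<open>A neighbourhood of minus infinity contains a ray, so the upper bound alone
      suffices.\<close>
    then obtain r where r: "{..<ereal r} \<subseteq> U" using U open_MInfty by auto
    have "growth < ereal r" using MInf by simp
    then obtain L and \<delta> :: real where "0 \<le> L" "0 < \<delta>" and
        *: "\<And>F. finite F \<Longrightarrow> F \<noteq> {} \<Longrightarrow> real (card (collar L F)) < \<delta> * real (card F) \<Longrightarrow> P F < exp (r * real (card F))"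
      using P_less_of_growth_less by meson
    have "log_ext (P F) / ereal (real (card F)) \<in> U"
      if "finite F" "F \<noteq> {}" "real (card (collar L F)) < \<delta> * real (card F)" for F
    proof -
      have "0 < card F" using that by (simp add: card_gt_0_iff)
      then show ?thesis using *[OF that] log_ext_div_less_iff[OF P_nonneg, of "card F" F r] r by auto
    qed
    then show ?thesis using \<open>0 \<le> L\<close> \<open>0 < \<delta>\<close> by blast
  next
    case (real l)
    then obtain a b where ab: "a < growth" "growth < b" "{a<..<b} \<subseteq> U"
      using ereal_open_cont_interval2[OF U] by auto
    obtain p where p: "a < ereal p" "ereal p < growth" using ereal_dense2[OF ab(1)] by blast
    obtain r where r: "growth < ereal r" "ereal r < b" using ereal_dense2[OF ab(2)] by blast
    have sub: "{ereal p<..<ereal r} \<subseteq> U"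
    proof (rule order_trans[OF _ ab(3)])
      show "{ereal p<..<ereal r} \<subseteq> {a<..<b}"
        using p(1) r(2) by (auto intro: less_trans)
    qed
    obtain L and \<delta> :: real where L: "0 \<le> L" "0 < \<delta>" and
        up: "\<And>F. finite F \<Longrightarrow> F \<noteq> {} \<Longrightarrow> real (card (collar L F)) < \<delta> * real (card F) \<Longrightarrow> P F < exp (r * real (card F))"
      using P_less_of_growth_less[OF r(1)] by meson
    obtain \<delta>' :: real where \<delta>': "0 < \<delta>'" and
        low: "\<And>F. finite F \<Longrightarrow> F \<noteq> {} \<Longrightarrow> real (card (collar (2 * d) F)) < \<delta>' * real (card F) \<Longrightarrow> exp (p * real (card F)) < P F"
      using P_greater_of_less_growth[OF p(2)] by meson
    \<comment> \<open>The collar of the larger radius contains both collars, so one Folner condition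
      yields both bounds.\<close>
    have "log_ext (P F) / ereal (real (card F)) \<in> U"
      if F: "finite F" "F \<noteq> {}" and small: "real (card (collar (max L (2 * d)) F)) < min \<delta> \<delta>' * real (card F)" for F
    proof -
      have pos: "0 < card F" using F by (simp add: card_gt_0_iff)
      have "card (collar L F) \<le> card (collar (max L (2 * d)) F)"
          "card (collar (2 * d) F) \<le> card (collar (max L (2 * d)) F)"
        using F(1) by (intro card_mono finite_collar collar_mono; simp)+
      moreover have "min \<delta> \<delta>' * real (card F) \<le> \<delta> * real (card F)"
          "min \<delta> \<delta>' * real (card F) \<le> \<delta>' * real (card F)"
        by (intro mult_right_mono; simp)+
      ultimately have "real (card (collar L F)) < \<delta> * real (card F)"
          "real (card (collar (2 * d) F)) < \<delta>' * real (card F)"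
        using small by linarith+
      then have "log_ext (P F) / ereal (real (card F)) < ereal r"
          "ereal p < log_ext (P F) / ereal (real (card F))"
        using up low F log_ext_div_less_iff[OF P_nonneg pos] less_log_ext_div_iff[OF P_nonneg pos] by auto
      then show ?thesis using sub by auto
    qed
    moreover have "0 \<le> max L (2 * d)" "0 < min \<delta> \<delta>'" using L \<delta>' by auto
    ultimately show ?thesis by blast
  qed (use growth_less_infinity in simp)
  then obtain L and \<delta> :: real where L: "0 \<le> L" "0 < \<delta>"
    and *: "\<And>F. finite F \<Longrightarrow> F \<noteq> {} \<Longrightarrow> real (card (collar L F)) < \<delta> * real (card F)
      \<Longrightarrow> log_ext (P F) / ereal (real (card F)) \<in> U"
    by meson
  show "\<exists>K\<in>nonempty_finite_subsets integer_group. \<exists>\<delta>>0. \<forall>F\<in>nonempty_finite_subsets integer_group.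
      real (card (sym_diff (F <#>\<^bsub>integer_group\<^esub> K) F)) < \<delta> * real (card F) \<longrightarrow>
      log_ext (P F) / ereal (real (card F)) \<in> U"
  proof (intro bexI[of _ "{-L..L}"] exI[of _ \<delta>] conjI ballI impI)
    fix F assume "F \<in> nonempty_finite_subsets integer_group"
      and "real (card (sym_diff (F <#>\<^bsub>integer_group\<^esub> {-L..L}) F)) < \<delta> * real (card F)"
    then show "log_ext (P F) / ereal (real (card F)) \<in> U"
      unfolding sym_diff_set_mult_eq_collar[OF L(1)]
      by (intro *) (auto simp: nonempty_finite_subsets_def)
  qed (use L in \<open>auto simp: nonempty_finite_subsets_def\<close>)
qed

section \<open>Comparison of the growth rate with the cyclic sums\<close>

lemma eventually_P_interval_less:
  assumes "growth < ereal r"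
  shows "\<forall>\<^sub>F n in sequentially. P {0..<int n} < exp (r * real n)"
proof -
  obtain L and \<delta> :: real where L: "0 \<le> L" "0 < \<delta>" and
      *: "\<And>F. finite F \<Longrightarrow> F \<noteq> {} \<Longrightarrow> real (card (collar L F)) < \<delta> * real (card F) \<Longrightarrow> P F < exp (r * real (card F))"
    using P_less_of_growth_less[OF assms] by meson
  have K: "{-L..L} \<in> nonempty_finite_subsets integer_group"
    using L by (auto simp: nonempty_finite_subsets_def)
  show ?thesis
    using integer_group_folner_interval[OF K L(2)] eventually_gt_at_top[of 0]
  proof eventually_elim
    case (elim n)
    then show ?case
      using *[of "{0..<int n}"] by (simp add: sym_diff_set_mult_eq_collar[OF L(1)])
  qed
qed

text \<open>The constant absorbs the finitely many short intervals, so that the bound also covers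
  the empty outer pieces that occur at \<open>a = 0\<close> and \<open>b = N\<close> below.\<close>

lemma P_interval_le_const_mult:
  assumes "growth < ereal q"
  shows "\<exists>K\<ge>1. \<forall>n. P {0..<int n} \<le> K * exp (q * real n)"
proof -
  obtain n0 where n0: "\<And>n. n0 \<le> n \<Longrightarrow> P {0..<int n} < exp (q * real n)"
    using eventually_P_interval_less[OF assms] unfolding eventually_sequentially by blast
  define K where "K = 1 + (\<Sum>i<n0. P {0..<int i} / exp (q * real i))"
  have nonneg: "0 \<le> (\<Sum>i<n0. P {0..<int i} / exp (q * real i))"
    by (intro sum_nonneg divide_nonneg_pos P_nonneg) auto
  have "P {0..<int n} \<le> K * exp (q * real n)" for n
  proof (cases "n0 \<le> n")
    case True
    have "exp (q * real n) \<le> K * exp (q * real n)" using nonneg by (simp add: K_def)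
    then show ?thesis using n0[OF True] by linarith
  next
    case False
    then have "P {0..<int n} / exp (q * real n) \<le> (\<Sum>i<n0. P {0..<int i} / exp (q * real i))"
      by (intro member_le_sum) (auto intro: divide_nonneg_pos P_nonneg)
    then have "P {0..<int n} / exp (q * real n) \<le> K" by (simp add: K_def)
    then show ?thesis by (simp add: pos_divide_le_eq)
  qed
  moreover have "1 \<le> K" using nonneg by (simp add: K_def)
  ultimately show ?thesis by blast
qed

text \<open>If \<open>T\<close> had a rate \<open>r\<close> below \<open>growth\<close>, each
  summand of the cyclic decomposition would lose an exponential factor in \<open>m\<close>. The
  number of summands depends only on \<open>d\<close>, so for large \<open>m\<close> the sum falls
  below the lower bound for \<open>P\<close>.\<close>

lemma growth_le_of_T_bound:
  assumes T: "\<And>n. n0 \<le> n \<Longrightarrow> T n \<le> exp (r * real n)"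
  shows "growth \<le> ereal r"
proof (rule ccontr)
  assume "\<not> growth \<le> ereal r"
  then obtain l where l: "growth = ereal l" "r < l"
    using growth_less_infinity by (cases growth) auto
  define N :: nat where "N = 2 ^ nat (2 * d)"
  have N: "1 \<le> real N" by (simp add: N_def)
  \<comment> \<open>The upper and lower bounds for \<open>P\<close> together lose
    \<open>2 * N * \<eta>\<close> per unit of \<open>m\<close>, which is half of the gain
    \<open>\<epsilon>\<close>.\<close>
  define \<epsilon> \<eta> where "\<epsilon> = l - r" and "\<eta> = \<epsilon> / (4 * real N)"
  have \<epsilon>: "0 < \<epsilon>" and \<eta>: "0 < \<eta>" using l N by (auto simp: \<epsilon>_def \<eta>_def)
  have N\<eta>: "4 * (real N * \<eta>) = \<epsilon>" using N by (simp add: \<eta>_def)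
  have low: "exp ((l - \<eta>) * real n) \<le> P {0..<int n}" for n
    using l \<eta> by (intro interval_bound_of_less_growth) simp
  obtain K where K: "1 \<le> K" and up: "\<And>n. P {0..<int n} \<le> K * exp ((l + \<eta>) * real n)"
    using P_interval_le_const_mult[of "l + \<eta>"] l \<eta> by auto
  define Q where "Q = {(a, b). a < b \<and> b \<le> N}"
  define B where "B = real (card Q) * (K * K)"
  obtain m1 where m1: "2 * B / \<epsilon> < real m1" using reals_Archimedean2 by blast
  \<comment> \<open>Large enough for the pieces to close up, for the bound on \<open>T\<close> to
    apply, and for the final contradiction with \<open>B\<close>.\<close>
  define m where "m = m1 + n0 + nat (2 * d) + 1"
  have m: "2 * d < int m" "n0 \<le> m" "m1 \<le> m" by (auto simp: m_def)
  have summand: "P {0..<int (a * m)} * (T ((b - a) * m) * P {0..<int ((N - b) * m)})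
      \<le> K * K * exp (real m * ((l + \<eta>) * real N - \<epsilon> - \<eta>))"
    if ab: "a < b" "b \<le> N" for a b
  proof -
    define k where "k = b - a"
    have k: "1 \<le> k" using ab by (simp add: k_def)
    have "1 * m \<le> k * m" using k by (intro mult_right_mono) auto
    then have "n0 \<le> k * m" using m(2) by linarith
    then have Tk: "T (k * m) \<le> exp (r * real (k * m))" by (rule T)
    have "P {0..<int (a * m)} * (T (k * m) * P {0..<int ((N - b) * m)})
        \<le> (K * exp ((l + \<eta>) * real (a * m))) * (exp (r * real (k * m)) * (K * exp ((l + \<eta>) * real ((N - b) * m))))"
      using K by (intro mult_mono up Tk mult_nonneg_nonneg P_nonneg T_nonneg) auto
    also have "\<dots> = K * K * exp ((l + \<eta>) * real (a * m) + r * real (k * m) + (l + \<eta>) * real ((N - b) * m))"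
      by (simp add: exp_add algebra_simps)
    \<comment> \<open>The three lengths add up to \<open>N * m\<close>, and the rate on the middle
      one is lower by \<open>\<epsilon> + \<eta>\<close>.\<close>
    also have "(l + \<eta>) * real (a * m) + r * real (k * m) + (l + \<eta>) * real ((N - b) * m)
        = real m * ((l + \<eta>) * real N - (\<epsilon> + \<eta>) * real k)"
      using ab by (simp add: k_def of_nat_diff \<epsilon>_def algebra_simps)
    also have "K * K * exp (real m * ((l + \<eta>) * real N - (\<epsilon> + \<eta>) * real k))
        \<le> K * K * exp (real m * ((l + \<eta>) * real N - \<epsilon> - \<eta>))"
    proof -
      have "(\<epsilon> + \<eta>) * 1 \<le> (\<epsilon> + \<eta>) * real k" using k \<epsilon> \<eta> by (intro mult_left_mono) auto
      then have "real m * ((l + \<eta>) * real N - (\<epsilon> + \<eta>) * real k) \<le> real m * ((l + \<eta>) * real N - \<epsilon> - \<eta>)"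
        by (intro mult_left_mono) auto
      then show ?thesis using K by (intro mult_left_mono) auto
    qed
    finally show ?thesis unfolding k_def .
  qed
  have "exp ((l - \<eta>) * real (N * m)) \<le> P {0..<int (N * m)}" by (rule low)
  also have "\<dots> \<le> (\<Sum>(a, b)\<in>Q. P {0..<int (a * m)} * (T ((b - a) * m) * P {0..<int ((N - b) * m)}))"
    unfolding Q_def by (rule P_le_cyclic_decomposition[OF m(1) N_def])
  also have "\<dots> \<le> (\<Sum>q\<in>Q. K * K * exp (real m * ((l + \<eta>) * real N - \<epsilon> - \<eta>)))"
    using summand by (intro sum_mono) (auto simp: Q_def)
  also have "\<dots> = B * exp (real m * ((l + \<eta>) * real N - \<epsilon> - \<eta>))"
    by (simp add: B_def)
  finally have "exp ((l - \<eta>) * real (N * m)) / exp (real m * ((l + \<eta>) * real N - \<epsilon> - \<eta>)) \<le> B"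
    by (simp add: pos_divide_le_eq)
  then have "exp ((l - \<eta>) * real (N * m) - real m * ((l + \<eta>) * real N - \<epsilon> - \<eta>)) \<le> B"
    by (simp add: exp_diff)
  moreover have "(l - \<eta>) * real (N * m) - real m * ((l + \<eta>) * real N - \<epsilon> - \<eta>) = real m * (\<epsilon> + \<eta> - 2 * (real N * \<eta>))"
    by (simp add: algebra_simps)
  moreover have "real m * (\<epsilon> / 2) \<le> real m * (\<epsilon> + \<eta> - 2 * (real N * \<eta>))"
    using N\<eta> \<eta> by (intro mult_left_mono) auto
  \<comment> \<open>From \<open>1 + y \<le> exp y\<close>, which bounds an exponent growing linearly
    in \<open>m\<close> by the fixed \<open>B\<close>.\<close>
  ultimately have "real m * (\<epsilon> / 2) < B"
    by (smt (verit) exp_ge_add_one_self)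
  moreover have "2 * B / \<epsilon> < real m" using m1 m(3) by linarith
  ultimately show False using \<epsilon> by (simp add: pos_divide_less_eq)
qed

text \<open>One direction is \<open>T_le_P\<close>. For the other, a limsup below
  \<open>growth\<close> would give an eventual bound on \<open>T\<close> at a rate
  \<open>r < growth\<close>, contradicting \<open>growth_le_of_T_bound\<close>.\<close>

lemma limsup_T: "limsup (\<lambda>n. log_ext (T n) / ereal (real n)) = growth"
proof (rule antisym)
  show "limsup (\<lambda>n. log_ext (T n) / ereal (real n)) \<le> growth"
  proof (rule dense_ge)
    fix x assume "growth < x"
    then obtain r where r: "growth < ereal r" "ereal r < x" using ereal_dense2 by blast
    have "\<forall>\<^sub>F n in sequentially. log_ext (T n) / ereal (real n) \<le> x"
      using eventually_P_interval_less[OF r(1)] eventually_gt_at_top[of 0]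
    proof eventually_elim
      case (elim n)
      then have "T n < exp (r * real n)" using T_le_P[of n] by simp
      then have "log_ext (T n) / ereal (real n) < ereal r"
        using log_ext_div_less_iff[OF T_nonneg, of n n r] elim(2) by simp
      then show ?case using r(2) by simp
    qed
    then show "limsup (\<lambda>n. log_ext (T n) / ereal (real n)) \<le> x" by (rule Limsup_bounded)
  qed
  show "growth \<le> limsup (\<lambda>n. log_ext (T n) / ereal (real n))"
  proof (rule ccontr)
    assume "\<not> ?thesis"
    then obtain r where r: "limsup (\<lambda>n. log_ext (T n) / ereal (real n)) < ereal r" "ereal r < growth"
      using ereal_dense2 by (meson not_le)
    have "\<forall>\<^sub>F n in sequentially. T n \<le> exp (r * real n)"
      using Limsup_lessD[OF r(1)] eventually_gt_at_top[of 0]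
    proof eventually_elim
      case (elim n)
      then show ?case using log_ext_div_less_iff[OF T_nonneg, of n n r] by simp
    qed
    then obtain n0 where "\<And>n. n0 \<le> n \<Longrightarrow> T n \<le> exp (r * real n)"
      unfolding eventually_sequentially by blast
    then have "growth \<le> ereal r" by (rule growth_le_of_T_bound)
    then show False using r(2) by simp
  qed
qed

end

text \<open>Since \<open>L\<close> does not involve \<open>A\<close>, this gives at once that the
  Folner limit exists and that it is the same for all admissible \<open>A\<close>.\<close>

lemma has_folner_limit_limsup_per:
  assumes nonneg: "\<forall>s. 0 \<le> Poly_Mapping.lookup f s"
    and A: "finite A" "A \<noteq> {}" "Poly_Mapping.keys f \<subseteq> A"
  defines "L \<equiv> limsup (\<lambda>n. per (integer_mod_group n) (mod_proj n f))"
  shows "has_folner_limit integer_group (local_per integer_group A f) L \<and> L < \<infinity>"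
proof -
  define d where "d = Max (abs ` A)"
  have abs: "\<bar>a\<bar> \<le> d" if "a \<in> A" for a using that A(1) by (auto simp: d_def)
  have bounded: "A \<subseteq> {-d..d}"
  proof
    fix a assume "a \<in> A"
    then show "a \<in> {-d..d}" using abs[of a] by auto
  qed
  interpret weighted_shifts "Poly_Mapping.lookup f" A d
    using nonneg A bounded by unfold_locales auto
  have "L = limsup (\<lambda>n. log_ext (T n) / ereal (real n))"
    unfolding L_def
  \<comment> \<open>The term at \<open>n = 0\<close>, where \<open>integer_mod_group 0\<close> is
    the group of integers itself, does not affect the limsup.\<close>
  proof (rule Limsup_eq)
    show "\<forall>\<^sub>F n in sequentially. per (integer_mod_group n) (mod_proj n f) = log_ext (T n) / ereal (real n)"
      using eventually_gt_at_top[of 0] by eventually_elim (simp add: per_integer_mod_group A)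
  qed
  then have "L = growth" by (simp add: limsup_T)
  moreover have "local_per integer_group A f = (\<lambda>F. log_ext (P F) / ereal (real (card F)))"
    by (simp add: fun_eq_iff local_per_def P_def weight_sum_def)
  ultimately show ?thesis
    using has_folner_limit_growth growth_less_infinity by simp
qed

theorem corollary6p3:
  fixes f :: "int \<Rightarrow>\<^sub>0 real"
  assumes "\<forall>s. 0 \<le> Poly_Mapping.lookup f s"
  shows "per integer_group f = limsup (\<lambda>n. per (integer_mod_group n) (mod_proj n f))"
  unfolding per_def[of integer_group]
proof (rule the_equality)
  show "limsup (\<lambda>n. per (integer_mod_group n) (mod_proj n f)) < \<infinity> \<and>
    (\<forall>A\<in>nonempty_finite_subsets integer_group. Poly_Mapping.keys f \<subseteq> A \<longrightarrow>
      has_folner_limit integer_group (local_per integer_group A f)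
        (limsup (\<lambda>n. per (integer_mod_group n) (mod_proj n f))))"
    \<comment> \<open>Inserting 0 gives an admissible set even for \<open>f = 0\<close>; one such
      set is enough for finiteness from above.\<close>
    using has_folner_limit_limsup_per[OF assms]
      has_folner_limit_limsup_per[OF assms, of "insert 0 (Poly_Mapping.keys f)"]
    by (auto simp: nonempty_finite_subsets_def)
next
  fix x
  let ?A = "insert 0 (Poly_Mapping.keys f)"
  assume "x < \<infinity> \<and> (\<forall>A\<in>nonempty_finite_subsets integer_group. Poly_Mapping.keys f \<subseteq> A \<longrightarrow>
      has_folner_limit integer_group (local_per integer_group A f) x)"
  moreover have "?A \<in> nonempty_finite_subsets integer_group"
    by (auto simp: nonempty_finite_subsets_def)
  ultimately have "has_folner_limit integer_group (local_per integer_group ?A f) x" by blast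
  then show "x = limsup (\<lambda>n. per (integer_mod_group n) (mod_proj n f))"
    using has_folner_limit_limsup_per[OF assms, of ?A]
    by (auto intro: has_folner_limit_integer_group_unique)
qed

end
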